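(* Let $x$ be a one-dimensional fractional Brownian motion on $[0,1]$ with Hurst parameter $0<\nu\le\frac12$, and let $(z,z')$ be a controlled process of order $2$ with respect to $x$, with $$|r^z_{st}|\le G(t-s)^{2\nu},\qquad r^z_{st}:=\delta z_{st}-z'_s\,\delta x_{st},$$ for an almost surely finite random variable $G$. Let $t_k=k/n$. Then for $p>\frac1{2\nu}$, almost surely as $n\to\infty$, $$\frac1n\sum_{k=0}^{n-1}|n^\nu\delta z_{t_kt_{k+1}}|^p\longrightarrow c_p\int_0^1|z'_t|^p\,dt .$$
   Context: $\delta z_{st}=z_t-z_s$. $c_p=\mathbb E|N|^p=\frac{2^{p/2}}{\sqrt\pi}\Gamma(\frac{p+1}2)$ for $N$ standard normal. A controlled process of order $2$ with respect to $x$ (almost surely) is a pair of continuous processes $(z,z')$ on $[0,1]$ with $z_0=0$ such that, for an a.s. finite random variable $G$, $|z_t-z_s-z'_s\delta x_{st}|\le G(t-s)^{2\nu}$ and $|z'_t-z'_s|\le G(t-s)^\nu$ for all $0\le s\le t\le1$. *)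

theory Defs
  imports "HOL-Probability.Probability"
begin

text \<open>Processes on $[0,1]$ are functions \<open>real \<Rightarrow> 'a \<Rightarrow> real\<close> (time first, then the sample point)
  that are constrained only for times in \<open>{0..1}\<close>.\<close>

definition increment :: "(real \<Rightarrow> 'a \<Rightarrow> real) \<Rightarrow> real \<Rightarrow> real \<Rightarrow> 'a \<Rightarrow> real" where
  "increment z s t \<omega> = z t \<omega> - z s \<omega>"

definition continuous_process :: "'a measure \<Rightarrow> (real \<Rightarrow> 'a \<Rightarrow> real) \<Rightarrow> bool" where
  "continuous_process M z \<longleftrightarrow>
     (\<forall>t\<in>{0..1}. z t \<in> borel_measurable M) \<and>
     (AE \<omega> in M. continuous_on {0..1} (\<lambda>t. z t \<omega>))"

text \<open>The second disjunct is the degenerate Gaussian law of variance $0$, needed below because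
  linear combinations of the values of a process may be almost surely constant.\<close>

definition gaussian_rv :: "'a measure \<Rightarrow> ('a \<Rightarrow> real) \<Rightarrow> bool" where
  "gaussian_rv M X \<longleftrightarrow> X \<in> borel_measurable M \<and>
     ((\<exists>\<mu> \<sigma>. 0 < \<sigma> \<and> distributed M lborel X (normal_density \<mu> \<sigma>)) \<or>
      (\<exists>\<mu>. AE \<omega> in M. X \<omega> = \<mu>))"

definition gaussian_process :: "'a measure \<Rightarrow> (real \<Rightarrow> 'a \<Rightarrow> real) \<Rightarrow> bool" where
  "gaussian_process M x \<longleftrightarrow>
     (\<forall>T a. finite T \<and> T \<subseteq> {0..1} \<longrightarrow> gaussian_rv M (\<lambda>\<omega>. \<Sum>t\<in>T. a t * x t \<omega>))"

definition fractional_brownian_motion ::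
    "'a measure \<Rightarrow> real \<Rightarrow> (real \<Rightarrow> 'a \<Rightarrow> real) \<Rightarrow> bool" where
  "fractional_brownian_motion M \<nu> x \<longleftrightarrow>
     continuous_process M x \<and> gaussian_process M x \<and>
     (\<forall>t\<in>{0..1}. (LINT \<omega>|M. x t \<omega>) = 0) \<and>
     (\<forall>s\<in>{0..1}. \<forall>t\<in>{0..1}. (LINT \<omega>|M. x s \<omega> * x t \<omega>) =
        (s powr (2 * \<nu>) + t powr (2 * \<nu>) - \<bar>t - s\<bar> powr (2 * \<nu>)) / 2)"

definition remainder ::
    "(real \<Rightarrow> 'a \<Rightarrow> real) \<Rightarrow> (real \<Rightarrow> 'a \<Rightarrow> real) \<Rightarrow> (real \<Rightarrow> 'a \<Rightarrow> real) \<Rightarrow>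
     real \<Rightarrow> real \<Rightarrow> 'a \<Rightarrow> real" where
  "remainder x z z' s t \<omega> = increment z s t \<omega> - z' s \<omega> * increment x s t \<omega>"

definition as_finite_rv :: "'a measure \<Rightarrow> ('a \<Rightarrow> ereal) \<Rightarrow> bool" where
  "as_finite_rv M G \<longleftrightarrow> G \<in> borel_measurable M \<and> (AE \<omega> in M. \<bar>G \<omega>\<bar> \<noteq> \<infinity>)"

definition controlled_process ::
    "'a measure \<Rightarrow> real \<Rightarrow> (real \<Rightarrow> 'a \<Rightarrow> real) \<Rightarrow> (real \<Rightarrow> 'a \<Rightarrow> real) \<Rightarrow>
     (real \<Rightarrow> 'a \<Rightarrow> real) \<Rightarrow> bool" where
  "controlled_process M \<nu> x z z' \<longleftrightarrow>
     continuous_process M z \<and> continuous_process M z' \<and>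
     (AE \<omega> in M. z 0 \<omega> = 0) \<and>
     (\<exists>G. as_finite_rv M G \<and>
       (AE \<omega> in M. \<forall>s t. 0 \<le> s \<and> s \<le> t \<and> t \<le> 1 \<longrightarrow>
          ereal \<bar>remainder x z z' s t \<omega>\<bar> \<le> G \<omega> * ereal ((t - s) powr (2 * \<nu>)) \<and>
          ereal \<bar>increment z' s t \<omega>\<bar> \<le> G \<omega> * ereal ((t - s) powr \<nu>)))"

definition abs_normal_moment :: "real \<Rightarrow> real" where
  "abs_normal_moment p = (LINT u|density lborel std_normal_density. \<bar>u\<bar> powr p)"

end

theory Submission
  imports Defs "HOL-Real_Asymp.Real_Asymp"
begin

text \<open>
  Put \<open>Y n k = n powr \<nu> * (x ((k+1)/n) - x (k/n))\<close>. These are standard normal variables, and at the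
  grid points \<open>n powr \<nu> * \<delta>z\<close> equals \<open>z' (k/n) * Y n k\<close> up to an error of order
  \<open>n powr (- \<nu>)\<close>, which does not affect power means
  (\<open>power_mean_perturbation\<close>). It remains to show that, almost surely, the weighted averages of
  \<open>\<bar>Y n k\<bar> powr p\<close> with weights \<open>h (k/n)\<close> converge to \<open>c\<^sub>p\<close> times the integral of \<open>h\<close>, for all
  continuous \<open>h\<close> at once; the path \<open>t \<mapsto> \<bar>z' t\<bar> powr p\<close> is then one such \<open>h\<close>.

  For \<open>\<nu> \<le> 1/2\<close> distinct increments are nonpositively correlated, and each row of absolute
  correlations sums to at most \<open>2\<close> (\<open>sum_abs_fgn_cov_le\<close>). A law of large numbers for a triangular array
  needs more than variances, because variances of averages are only of order \<open>1/n\<close>. Fourth moments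
  of order \<open>1/n\<^sup>2\<close> are enough, but they are awkward to compute for \<open>\<bar>Y\<bar> powr p\<close>. They are explicit
  for the functions \<open>cos (l * Y)\<close> and \<open>cosh (l * Y)\<close>: after centring, a mixed fourth moment becomes
  a polynomial in \<open>exp (s * r) - 1\<close>, with \<open>r\<close> running over the six pairwise correlations, and each of its
  monomials corresponds to a graph on the four variables without isolated vertices
  (\<open>alternating_sum_expand\<close>, \<open>fourth_moment_bound\<close>). Summing over all indices gives the bound
  (\<open>weighted_sum_fourth_moment\<close>), hence almost sure convergence for countably many cosines, one
  hyperbolic cosine and all monomial weights (\<open>AE_dalembert_averages\<close>).

  The rest is deterministic approximation at a fixed sample point. Up to a small multiple of
  \<open>1 + cosh u\<close>, the function \<open>\<bar>u\<bar> powr p\<close> is a polynomial in \<open>cos (pi / K * u)\<close>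
  (\<open>abs_powr_trig_approx\<close>): the cosines capture a bounded region, and the convergent averages of \<open>cosh\<close>
  control the tails. Continuous weights
  are reached from monomials by the Weierstrass theorem.
\<close>

section \<open>Gaussian means of cosines and hyperbolic cosines\<close>

text \<open>Completing the square turns \<open>exp (a * u)\<close> times the standard density into a multiple of the normal
  density with mean \<open>a\<close>.\<close>

lemma has_bochner_integral_exp_std_normal:
  "has_bochner_integral std_normal_distribution (\<lambda>u. exp (a * u)) (exp (a\<^sup>2 / 2))"
proof -
  have eq: "std_normal_density u *\<^sub>R exp (a * u) = exp (a\<^sup>2 / 2) * normal_density a 1 u" for u
    by (simp add: normal_density_def exp_add[symmetric] field_simps power2_eq_square)
  have "has_bochner_integral lborel (\<lambda>u. exp (a\<^sup>2 / 2) * normal_density a 1 u) (exp (a\<^sup>2 / 2) * 1)"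
    by (intro has_bochner_integral_mult_right) (simp add: has_bochner_integral_iff)
  then show ?thesis
    by (intro has_bochner_integral_density) (auto simp only: eq mult_1_right normal_density_nonneg measurable_lborel2 AE_I2, auto)
qed

lemma has_bochner_integral_cosh_std_normal:
  "has_bochner_integral std_normal_distribution (\<lambda>u. cosh (a * u)) (exp (a\<^sup>2 / 2))"
proof -
  have "has_bochner_integral std_normal_distribution (\<lambda>u. (exp (a * u) + exp ((- a) * u)) / 2)
      ((exp (a\<^sup>2 / 2) + exp ((- a)\<^sup>2 / 2)) / 2)"
    by (intro has_bochner_integral_divide_zero has_bochner_integral_add
        has_bochner_integral_exp_std_normal) 
  then show ?thesis by (simp add: cosh_field_def)
qed

lemma has_bochner_integral_cos_std_normal:
  "has_bochner_integral std_normal_distribution (\<lambda>u. cos (a * u)) (exp (- (a\<^sup>2) / 2))"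
proof -
  interpret prob_space std_normal_distribution
    using prob_space_normal_density[of 1 0] by simp
  have i: "integrable std_normal_distribution (\<lambda>u. iexp (a * u))"
    by (rule integrable_const_bound[where B = 1]) auto
  have "(LINT u|std_normal_distribution. Re (iexp (a * u))) = exp (- (a\<^sup>2) / 2)"
    using i char_std_normal_distribution by (subst integral_Re) (auto simp: char_def fun_eq_iff)
  moreover have "integrable std_normal_distribution (\<lambda>u. Re (iexp (a * u)))"
    using i by (rule integrable_Re)
  ultimately show ?thesis by (simp add: has_bochner_integral_iff Re_exp)
qed

text \<open>Both \<open>cos\<close> and \<open>cosh\<close> are needed below: cosines to approximate on bounded sets, the hyperbolic
  cosine to control tails. What the moment computation uses is common to the two: they are even solutions of
  d'Alembert's functional equation, so that products of values become averages of values at signed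
  sums, and their Gaussian means are exponentials of the variance, which turns correlations into
  factors \<open>exp (s * r)\<close>.\<close>

locale gaussian_dalembert =
  fixes c :: "real \<Rightarrow> real" and s :: real
  assumes product: "\<And>x y. c x * c y = (c (x + y) + c (x - y)) / 2"
    and even: "\<And>x. c (- x) = c x"
    and cont: "continuous_on UNIV c"
    and std_normal: "\<And>\<sigma>. has_bochner_integral std_normal_distribution (\<lambda>u. c (\<sigma> * u)) (exp (s * \<sigma>\<^sup>2 / 2))"
begin

lemma borel_measurable[measurable]: "c \<in> borel_measurable borel"
  using cont by (rule borel_measurable_continuous_onI)

lemma at_0: "c 0 = 1"
  using std_normal[of 0] prob_space.prob_space[OF prob_space_normal_density[of 1 0]]
  by (simp add: has_bochner_integral_iff)

end

lemma gaussian_dalembert_cos: "gaussian_dalembert (\<lambda>y. cos (l * y)) (- (l\<^sup>2))"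
proof
  show "has_bochner_integral std_normal_distribution (\<lambda>u. cos (l * (\<sigma> * u)))
      (exp (- (l\<^sup>2) * \<sigma>\<^sup>2 / 2))" for \<sigma>
    using has_bochner_integral_cos_std_normal[of "l * \<sigma>"]
    by (simp add: mult.assoc power_mult_distrib)
qed (auto intro!: continuous_intros simp: cos_times_cos algebra_simps)

lemma gaussian_dalembert_cosh: "gaussian_dalembert (\<lambda>y. cosh (l * y)) (l\<^sup>2)"
proof
  show "has_bochner_integral std_normal_distribution (\<lambda>u. cosh (l * (\<sigma> * u)))
      (exp (l\<^sup>2 * \<sigma>\<^sup>2 / 2))" for \<sigma>
    using has_bochner_integral_cosh_std_normal[of "l * \<sigma>"]
    by (simp add: mult.assoc power_mult_distrib)
qed (auto intro!: continuous_intros simp: cosh_add cosh_diff algebra_simps)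

section \<open>Linear spaces of centred Gaussian variables\<close>

text \<open>Joint Gaussianity enters only in the form that every linear combination is Gaussian; by linearity of
  the covariance, the mean of \<open>c\<close> at such a combination is then explicit.\<close>

locale centered_gaussian_space = prob_space M for M :: "'a measure" +
  fixes L :: "('a \<Rightarrow> real) set"
  assumes gaussian: "\<And>X. X \<in> L \<Longrightarrow> gaussian_rv M X"
    and centered: "\<And>X. X \<in> L \<Longrightarrow> expectation X = 0"
    and add: "\<And>X Y. X \<in> L \<Longrightarrow> Y \<in> L \<Longrightarrow> (\<lambda>\<omega>. X \<omega> + Y \<omega>) \<in> L"
    and scale: "\<And>a X. X \<in> L \<Longrightarrow> (\<lambda>\<omega>. a * X \<omega>) \<in> L"
begin

abbreviation cov :: "('a \<Rightarrow> real) \<Rightarrow> ('a \<Rightarrow> real) \<Rightarrow> real" where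
  "cov X Y \<equiv> expectation (\<lambda>\<omega>. X \<omega> * Y \<omega>)"

lemma measurable: "X \<in> L \<Longrightarrow> random_variable borel X"
  using gaussian by (auto simp: gaussian_rv_def)

lemma minus: "X \<in> L \<Longrightarrow> (\<lambda>\<omega>. - X \<omega>) \<in> L"
  using scale[of X "-1"] by simp

lemma cases:
  assumes "X \<in> L"
  obtains (normal) \<sigma> where "0 < \<sigma>" "distributed M lborel X (normal_density 0 \<sigma>)"
  | (zero) "AE \<omega> in M. X \<omega> = 0"
proof -
  from gaussian[OF assms]
  consider \<mu> \<sigma> where "0 < \<sigma>" "distributed M lborel X (normal_density \<mu> \<sigma>)"
    | \<mu> where "AE \<omega> in M. X \<omega> = \<mu>" unfolding gaussian_rv_def by blast
  then show thesis
  proof cases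
    case 1
    with centered[OF assms] have "\<mu> = 0" by (simp add: normal_distributed_expectation)
    with 1 show ?thesis using normal by blast
  next
    case 2
    have "expectation X = expectation (\<lambda>_. \<mu>)"
      using 2 measurable[OF assms] by (intro integral_cong_AE) auto
    with centered[OF assms] have "\<mu> = 0" by (simp add: prob_space)
    with 2 show ?thesis using zero by blast
  qed
qed

lemma square_integrable:
  assumes "X \<in> L" shows "integrable M (\<lambda>\<omega>. (X \<omega>)\<^sup>2)"
  using assms
proof (cases rule: cases)
  case (normal \<sigma>)
  show ?thesis
    using integrable_normal_moment[OF normal(1), of 0 2]
      distributed_integrable[OF normal(2), of "\<lambda>x. x\<^sup>2"] by simp
next
  case zero
  note [measurable] = measurable[OF assms]
  have "integrable M (\<lambda>\<omega>. 0 :: real)" by simp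
  then show ?thesis
    by (rule integrable_cong_AE_imp) (use zero in auto)
qed

lemma product_integrable:
  assumes "X \<in> L" "Y \<in> L" shows "integrable M (\<lambda>\<omega>. X \<omega> * Y \<omega>)"
proof (rule Bochner_Integration.integrable_bound)
  note [measurable] = measurable[OF assms(1)] measurable[OF assms(2)]
  show "integrable M (\<lambda>\<omega>. (X \<omega>)\<^sup>2 + (Y \<omega>)\<^sup>2)"
    using assms by (intro Bochner_Integration.integrable_add square_integrable)
  show "(\<lambda>\<omega>. X \<omega> * Y \<omega>) \<in> borel_measurable M" by measurable
  have "\<bar>x * y\<bar> \<le> x\<^sup>2 + y\<^sup>2" for x y :: real
    using sum_squares_bound[of "\<bar>x\<bar>" "\<bar>y\<bar>"] mult_nonneg_nonneg[of "\<bar>x\<bar>" "\<bar>y\<bar>"]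
    unfolding abs_mult power2_abs by linarith
  then show "AE \<omega> in M. norm (X \<omega> * Y \<omega>) \<le> norm ((X \<omega>)\<^sup>2 + (Y \<omega>)\<^sup>2)"
    by (auto simp: abs_mult)
qed

lemma cov_commute: "cov X Y = cov Y X"
  by (simp add: mult.commute)

lemma cov_add_left:
  "X \<in> L \<Longrightarrow> Y \<in> L \<Longrightarrow> Z \<in> L \<Longrightarrow> cov (\<lambda>\<omega>. X \<omega> + Y \<omega>) Z = cov X Z + cov Y Z"
  by (simp add: distrib_right product_integrable)

lemma cov_add_right:
  "X \<in> L \<Longrightarrow> Y \<in> L \<Longrightarrow> Z \<in> L \<Longrightarrow> cov Z (\<lambda>\<omega>. X \<omega> + Y \<omega>) = cov Z X + cov Z Y"
  by (simp add: distrib_left product_integrable)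

lemma has_bochner_integral_dalembert:
  assumes "gaussian_dalembert c s" and X: "X \<in> L"
  shows "has_bochner_integral M (\<lambda>\<omega>. c (X \<omega>)) (exp (s * cov X X / 2))"
proof -
  interpret gaussian_dalembert c s by fact
  note [measurable] = measurable[OF X]
  show ?thesis using X
  proof (cases rule: cases)
    case (normal \<sigma>)
    let ?Z = "\<lambda>\<omega>. X \<omega> / \<sigma>"
    have D: "distributed M lborel ?Z std_normal_density"
      using normal normal_standard_normal_convert[of \<sigma> X 0] by simp
    have X_eq: "X = (\<lambda>\<omega>. \<sigma> * ?Z \<omega>)" using normal(1) by auto
    have "cov X X = variance X"
      using centered[OF X] by (simp add: power2_eq_square)
    then have v: "cov X X = \<sigma>\<^sup>2" using normal_distributed_variance[OF normal] by simp
    have h: "has_bochner_integral lborel (\<lambda>u. std_normal_density u * c (\<sigma> * u)) (exp (s * \<sigma>\<^sup>2 / 2))"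
      using std_normal[of \<sigma>]
      by (simp add: has_bochner_integral_iff integrable_density integral_density)
    show ?thesis
      using h distributed_integrable[OF D, of "\<lambda>u. c (\<sigma> * u)"]
        distributed_integral[OF D, of "\<lambda>u. c (\<sigma> * u)"] normal(1)
      unfolding v by (simp add: has_bochner_integral_iff)
  next
    case zero
    have "cov X X = expectation (\<lambda>_. 0)" by (rule integral_cong_AE) (use zero in auto)
    moreover have "has_bochner_integral M (\<lambda>\<omega>. c (X \<omega>)) 1 \<longleftrightarrow>
        has_bochner_integral M (\<lambda>_. 1 :: real) 1"
      by (rule has_bochner_integral_cong_AE) (use zero at_0 in auto)
    ultimately show ?thesis by (simp add: has_bochner_integral_iff prob_space)
  qed
qed

end

section \<open>Fourth mixed moments\<close>

lemma abs_exp_minus_one_le: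
  fixes r s :: real
  assumes "\<bar>r\<bar> \<le> 1"
  shows "\<bar>exp (s * r) - 1\<bar> \<le> \<bar>s\<bar> * exp \<bar>s\<bar> * \<bar>r\<bar>"
proof -
  define x where "x = s * r"
  have x: "\<bar>x\<bar> \<le> \<bar>s\<bar>" using assms mult_left_le[of "\<bar>r\<bar>" "\<bar>s\<bar>"] by (simp add: x_def abs_mult)
  have "\<bar>exp x - 1\<bar> \<le> \<bar>x\<bar> * exp \<bar>x\<bar>"
  proof (cases "0 \<le> x")
    case True
    have "(1 - x) * exp x \<le> exp (- x) * exp x"
      using exp_ge_add_one_self[of "- x"] by (intro mult_right_mono) auto
    with True show ?thesis by (simp add: exp_minus algebra_simps)
  next
    case False
    have "1 - exp x \<le> - x" using exp_ge_add_one_self[of x] by linarith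
    also have "\<dots> \<le> - x * exp (- x)" using False mult_left_mono[of 1 "exp (- x)" "- x"] by simp
    finally show ?thesis using False by simp
  qed
  also have "\<dots> \<le> \<bar>x\<bar> * exp \<bar>s\<bar>" using x by (intro mult_left_mono) auto
  finally show ?thesis by (simp add: x_def abs_mult mult_ac)
qed

text \<open>The values \<open>r12, \<dots>, r34\<close> label the edges of the complete graph on four vertices. The first
  three products are the perfect matchings; the other four are pairs of edges at a common vertex, one
  pair out of each star centred at vertex 1, 2, 3, 4. Two factors per product are enough: with
  bounded row sums, summing over four indices costs only the square of the number of indices.\<close>

definition edge_sum :: "real \<Rightarrow> real \<Rightarrow> real \<Rightarrow> real \<Rightarrow> real \<Rightarrow> real \<Rightarrow> real" where
  "edge_sum r12 r13 r14 r23 r24 r34 =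
     \<bar>r12 * r34\<bar> + \<bar>r13 * r24\<bar> + \<bar>r14 * r23\<bar> +
     \<bar>r12 * r13\<bar> + \<bar>r12 * r23\<bar> + \<bar>r13 * r23\<bar> + \<bar>r14 * r24\<bar>"

text \<open>With \<open>eij = exp (s * rij)\<close> this is the inclusion-exclusion sum over the subsets \<open>S\<close> of four
  vertices of \<open>(-1) ^ card S\<close> times the product of the \<open>eij\<close> over the edges inside \<open>S\<close>; the
  constant is \<open>1 - 4\<close>, from the empty set and the singletons.\<close>

definition alternating_sum :: "real \<Rightarrow> real \<Rightarrow> real \<Rightarrow> real \<Rightarrow> real \<Rightarrow> real \<Rightarrow> real" where
  "alternating_sum e12 e13 e14 e23 e24 e34 =
     e12 * e13 * e14 * e23 * e24 * e34
     - (e12 * e13 * e23 + e12 * e14 * e24 + e13 * e14 * e34 + e23 * e24 * e34)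
     + (e12 + e13 + e14 + e23 + e24 + e34) - 3"

text \<open>After substituting \<open>eij = 1 + uij\<close>, the alternating signs cancel every monomial whose graph leaves a
  vertex isolated. A graph on four vertices without isolated vertices contains a perfect matching or
  is one of the four stars; the first three summands collect the graphs by the first matching
  that they contain.\<close>

lemma alternating_sum_expand:
  fixes u12 :: real
  shows "alternating_sum (1 + u12) (1 + u13) (1 + u14) (1 + u23) (1 + u24) (1 + u34) =
    u12 * u34 * ((1 + u13) * (1 + u14) * (1 + u23) * (1 + u24)) +
    u13 * u24 * ((1 + u14) * (1 + u23) * (1 + u12 + u34)) +
    u14 * u23 * ((1 + u12 + u34) * (1 + u13 + u24)) +
    u12 * u13 * u14 + u12 * u23 * u24 + u13 * u23 * u34 + u14 * u24 * u34"
  unfolding alternating_sum_def by algebra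

lemma abs_alternating_sum_le:
  fixes A :: real
  assumes u: "\<bar>u12\<bar> \<le> A * \<bar>r12\<bar>" "\<bar>u13\<bar> \<le> A * \<bar>r13\<bar>" "\<bar>u14\<bar> \<le> A * \<bar>r14\<bar>"
      "\<bar>u23\<bar> \<le> A * \<bar>r23\<bar>" "\<bar>u24\<bar> \<le> A * \<bar>r24\<bar>" "\<bar>u34\<bar> \<le> A * \<bar>r34\<bar>"
    and r: "\<bar>r12\<bar> \<le> 1" "\<bar>r13\<bar> \<le> 1" "\<bar>r14\<bar> \<le> 1" "\<bar>r23\<bar> \<le> 1" "\<bar>r24\<bar> \<le> 1" "\<bar>r34\<bar> \<le> 1"
    and A: "0 \<le> A"
  shows "\<bar>alternating_sum (1 + u12) (1 + u13) (1 + u14) (1 + u23) (1 + u24) (1 + u34)\<bar>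
    \<le> A\<^sup>2 * (1 + 2 * A) ^ 4 * edge_sum r12 r13 r14 r23 r24 r34"
proof -
  define B where "B = 1 + 2 * A"
  have B1: "1 \<le> B" using A by (simp add: B_def)
  have uA: "\<bar>u12\<bar> \<le> A" "\<bar>u13\<bar> \<le> A" "\<bar>u14\<bar> \<le> A" "\<bar>u23\<bar> \<le> A" "\<bar>u24\<bar> \<le> A" "\<bar>u34\<bar> \<le> A"
    using u r A by (meson mult_left_le order_trans)+
  have one: "\<bar>1 + v\<bar> \<le> B" if "\<bar>v\<bar> \<le> A" for v using that unfolding B_def by linarith
  have two: "\<bar>1 + v + w\<bar> \<le> B" if "\<bar>v\<bar> \<le> A" "\<bar>w\<bar> \<le> A" for v w
    using that unfolding B_def by linarith
  have up: "y \<le> B ^ 4" if "y \<le> B ^ k" "k \<le> 4" for y k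
    using that power_increasing[OF that(2) B1] by linarith
  have c1: "\<bar>(1 + u13) * (1 + u14) * (1 + u23) * (1 + u24)\<bar> \<le> B ^ 4"
    unfolding abs_mult power4_eq_xxxx by (intro mult_mono one uA mult_nonneg_nonneg) (use B1 in auto)
  have "\<bar>(1 + u14) * (1 + u23) * (1 + u12 + u34)\<bar> \<le> B ^ 3"
    unfolding abs_mult power3_eq_cube by (intro mult_mono one two uA mult_nonneg_nonneg) (use B1 in auto)
  then have c2: "\<bar>(1 + u14) * (1 + u23) * (1 + u12 + u34)\<bar> \<le> B ^ 4" by (rule up) simp
  have "\<bar>(1 + u12 + u34) * (1 + u13 + u24)\<bar> \<le> B ^ 2"
    unfolding abs_mult power2_eq_square by (intro mult_mono one two uA mult_nonneg_nonneg) (use B1 in auto)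
  then have c3: "\<bar>(1 + u12 + u34) * (1 + u13 + u24)\<bar> \<le> B ^ 4" by (rule up) simp
  have small: "\<bar>v\<bar> \<le> B ^ 4" if "\<bar>v\<bar> \<le> A" for v
    by (rule up[of _ 1]) (use that A in \<open>auto simp: B_def\<close>)
  have bd: "\<bar>v * w * z\<bar> \<le> A\<^sup>2 * B ^ 4 * \<bar>r * r'\<bar>"
    if "\<bar>v\<bar> \<le> A * \<bar>r\<bar>" "\<bar>w\<bar> \<le> A * \<bar>r'\<bar>" "\<bar>z\<bar> \<le> B ^ 4" for v w z r r'
  proof -
    have "\<bar>v * w * z\<bar> \<le> (A * \<bar>r\<bar>) * (A * \<bar>r'\<bar>) * B ^ 4"
      unfolding abs_mult using that A B1 by (intro mult_mono mult_nonneg_nonneg) auto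
    then show ?thesis by (simp add: abs_mult power2_eq_square mult_ac)
  qed
  note b1 = bd[OF u(1) u(6) c1] and b2 = bd[OF u(2) u(5) c2] and b3 = bd[OF u(3) u(4) c3]
    and b4 = bd[OF u(1) u(2) small[OF uA(3)]] and b5 = bd[OF u(1) u(4) small[OF uA(5)]]
    and b6 = bd[OF u(2) u(4) small[OF uA(6)]] and b7 = bd[OF u(3) u(5) small[OF uA(6)]]
  have tri: "\<bar>t1 + t2 + t3 + t4 + t5 + t6 + t7\<bar> \<le> \<bar>t1\<bar> + \<bar>t2\<bar> + \<bar>t3\<bar> + \<bar>t4\<bar> + \<bar>t5\<bar> + \<bar>t6\<bar> + \<bar>t7\<bar>"
    for t1 t2 t3 t4 t5 t6 t7 :: real
    by (intro order_trans[OF abs_triangle_ineq] add_mono order_refl)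
  have "\<bar>alternating_sum (1 + u12) (1 + u13) (1 + u14) (1 + u23) (1 + u24) (1 + u34)\<bar> \<le>
      A\<^sup>2 * B ^ 4 * \<bar>r12 * r34\<bar> + A\<^sup>2 * B ^ 4 * \<bar>r13 * r24\<bar> + A\<^sup>2 * B ^ 4 * \<bar>r14 * r23\<bar> +
      A\<^sup>2 * B ^ 4 * \<bar>r12 * r13\<bar> + A\<^sup>2 * B ^ 4 * \<bar>r12 * r23\<bar> + A\<^sup>2 * B ^ 4 * \<bar>r13 * r23\<bar> +
      A\<^sup>2 * B ^ 4 * \<bar>r14 * r24\<bar>"
    unfolding alternating_sum_expand
    by (rule order_trans[OF tri
        add_mono[OF add_mono[OF add_mono[OF add_mono[OF add_mono[OF add_mono[OF b1 b2] b3] b4] b5] b6] b7]])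
  then show ?thesis
    by (simp only: edge_sum_def distrib_left B_def)
qed

text \<open>The product of the four factors \<open>w * c yi - 1\<close> multiplied out, with each product of values of \<open>c\<close>
  replaced by the value of \<open>c\<close> at the sum.\<close>

definition inclusion_exclusion ::
    "(real \<Rightarrow> real) \<Rightarrow> real \<Rightarrow> real \<Rightarrow> real \<Rightarrow> real \<Rightarrow> real \<Rightarrow> real" where
  "inclusion_exclusion c w y1 y2 y3 y4 =
     w ^ 4 * c (y1 + y2 + y3 + y4)
     - w ^ 3 * (c (y1 + y2 + y3) + c (y1 + y2 + y4) + c (y1 + y3 + y4) + c (y2 + y3 + y4))
     + w ^ 2 * (c (y1 + y2) + c (y1 + y3) + c (y1 + y4) + c (y2 + y3) + c (y2 + y4) + c (y3 + y4))
     - w * (c y1 + c y2 + c y3 + c y4) + 1"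

text \<open>D'Alembert's equation says that \<open>c x * c y\<close> is the average of \<open>c\<close> at \<open>x \<plusminus> y\<close>; iterating it, and using
  that \<open>c\<close> is even, every product of up to four values is an average over signs. Averaging over all
  eight sign patterns serves all the partial products at once.\<close>

lemma (in gaussian_dalembert) prod4_eq_sign_average:
  "(w * c y1 - 1) * (w * c y2 - 1) * (w * c y3 - 1) * (w * c y4 - 1) =
    (inclusion_exclusion c w y1 y2 y3 y4 + inclusion_exclusion c w y1 y2 y3 (- y4) +
     inclusion_exclusion c w y1 y2 (- y3) y4 + inclusion_exclusion c w y1 y2 (- y3) (- y4) +
     inclusion_exclusion c w y1 (- y2) y3 y4 + inclusion_exclusion c w y1 (- y2) y3 (- y4) +
     inclusion_exclusion c w y1 (- y2) (- y3) y4 + inclusion_exclusion c w y1 (- y2) (- y3) (- y4)) / 8"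
proof -
  have p2: "c x * c y = (c (x + y) + c (x + - y)) / 2" for x y
    using product[of x y] by simp
  have p3: "c x * c y * c z =
      (c (x + y + z) + c (x + y + - z) + c (x + - y + z) + c (x + - y + - z)) / 4" for x y z
    unfolding p2 by (simp add: add_divide_distrib distrib_right p2[of _ z])
  have p4: "c x * c y * c z * c v =
      (c (x + y + z + v) + c (x + y + z + - v) + c (x + y + - z + v) + c (x + y + - z + - v)
       + c (x + - y + z + v) + c (x + - y + z + - v) + c (x + - y + - z + v) + c (x + - y + - z + - v)) / 8"
    for x y z v
    unfolding p3 by (simp add: add_divide_distrib distrib_right p2[of _ v])
  have e1: "c (- x + y) = c (x + - y)" "c (- x + - y) = c (x + y)" for x y
    using even[of "- x + y"] even[of "x + y"] by (simp_all add: add.commute)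
  have e2: "c (- x + y + z) = c (x + - y + - z)" "c (- x + - y + z) = c (x + y + - z)"
    "c (- x + y + - z) = c (x + - y + z)" "c (- x + - y + - z) = c (x + y + z)" for x y z
    using even[of "x - y - z"] even[of "x + y - z"] even[of "x - y + z"] even[of "x + y + z"]
    by (simp_all add: algebra_simps)
  have "(w * c y1 - 1) * (w * c y2 - 1) * (w * c y3 - 1) * (w * c y4 - 1) =
     w ^ 4 * (c y1 * c y2 * c y3 * c y4)
     - w ^ 3 * (c y1 * c y2 * c y3 + c y1 * c y2 * c y4 + c y1 * c y3 * c y4 + c y2 * c y3 * c y4)
     + w ^ 2 * (c y1 * c y2 + c y1 * c y3 + c y1 * c y4 + c y2 * c y3 + c y2 * c y4 + c y3 * c y4)
     - w * (c y1 + c y2 + c y3 + c y4) + 1"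
    by algebra
  also have "\<dots> = (inclusion_exclusion c w y1 y2 y3 y4 + inclusion_exclusion c w y1 y2 y3 (- y4) +
     inclusion_exclusion c w y1 y2 (- y3) y4 + inclusion_exclusion c w y1 y2 (- y3) (- y4) +
     inclusion_exclusion c w y1 (- y2) y3 y4 + inclusion_exclusion c w y1 (- y2) y3 (- y4) +
     inclusion_exclusion c w y1 (- y2) (- y3) y4 + inclusion_exclusion c w y1 (- y2) (- y3) (- y4)) / 8"
  proof -
    \<comment> \<open>Only the sums over the sign patterns matter; the linear terms do not see the signs.\<close>
    have collect: "((w ^ 4 * a1 - w ^ 3 * b1 + w ^ 2 * d1 - w * f + 1)
        + (w ^ 4 * a2 - w ^ 3 * b2 + w ^ 2 * d2 - w * f + 1)
        + (w ^ 4 * a3 - w ^ 3 * b3 + w ^ 2 * d3 - w * f + 1)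
        + (w ^ 4 * a4 - w ^ 3 * b4 + w ^ 2 * d4 - w * f + 1)
        + (w ^ 4 * a5 - w ^ 3 * b5 + w ^ 2 * d5 - w * f + 1)
        + (w ^ 4 * a6 - w ^ 3 * b6 + w ^ 2 * d6 - w * f + 1)
        + (w ^ 4 * a7 - w ^ 3 * b7 + w ^ 2 * d7 - w * f + 1)
        + (w ^ 4 * a8 - w ^ 3 * b8 + w ^ 2 * d8 - w * f + 1)) / 8
      = w ^ 4 * ((a1 + a2 + a3 + a4 + a5 + a6 + a7 + a8) / 8)
        - w ^ 3 * ((b1 + b2 + b3 + b4 + b5 + b6 + b7 + b8) / 8)
        + w ^ 2 * ((d1 + d2 + d3 + d4 + d5 + d6 + d7 + d8) / 8) - w * f + 1"
      for a1 a2 a3 a4 a5 a6 a7 a8 b1 b2 b3 b4 b5 b6 b7 b8 d1 d2 d3 d4 d5 d6 d7 d8 f :: real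
      by (simp add: distrib_left add_divide_distrib diff_divide_distrib)
    have cong: "w ^ 4 * a - w ^ 3 * b + w ^ 2 * d - f + 1 = w ^ 4 * a' - w ^ 3 * b' + w ^ 2 * d' - f + 1"
      if "a = a'" "b = b'" "d = d'" for a b d f a' b' d' :: real using that by simp
    show ?thesis
      unfolding inclusion_exclusion_def e1 e2 even minus_minus collect
      unfolding p4 unfolding p3 unfolding p2
      by (rule cong; simp only: add_divide_distrib; simp)
  qed
  finally show ?thesis .
qed

context centered_gaussian_space
begin

text \<open>The factor \<open>exp (- s / 2)\<close> per variable cancels the contribution of the unit variances, so each subset
  contributes exactly the exponentials of its correlations.\<close>

lemma has_bochner_integral_inclusion_exclusion:
  assumes c: "gaussian_dalembert c s"
    and L: "X1 \<in> L" "X2 \<in> L" "X3 \<in> L" "X4 \<in> L"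
    and unit: "cov X1 X1 = 1" "cov X2 X2 = 1" "cov X3 X3 = 1" "cov X4 X4 = 1"
  shows "has_bochner_integral M
      (\<lambda>\<omega>. inclusion_exclusion c (exp (- s / 2)) (X1 \<omega>) (X2 \<omega>) (X3 \<omega>) (X4 \<omega>))
      (alternating_sum (exp (s * cov X1 X2)) (exp (s * cov X1 X3)) (exp (s * cov X1 X4))
        (exp (s * cov X2 X3)) (exp (s * cov X2 X4)) (exp (s * cov X3 X4)))"
proof -
  define w where "w = exp (- s / 2)"
  note H = has_bochner_integral_dalembert[OF c]
  have h1: "has_bochner_integral M (\<lambda>\<omega>. w * c (X \<omega>)) 1"
    if "X \<in> L" "cov X X = 1" for X
  proof -
    have "w * exp (s * cov X X / 2) = 1" by (simp add: w_def that(2) mult_exp_exp)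
    with has_bochner_integral_mult_right[of w, OF H[OF that(1)]] show ?thesis by simp
  qed
  have h2: "has_bochner_integral M (\<lambda>\<omega>. w ^ 2 * c (X \<omega> + Y \<omega>)) (exp (s * cov X Y))"
    if "X \<in> L" "Y \<in> L" "cov X X = 1" "cov Y Y = 1" for X Y
  proof -
    have "cov (\<lambda>\<omega>. X \<omega> + Y \<omega>) (\<lambda>\<omega>. X \<omega> + Y \<omega>) = 2 + 2 * cov X Y"
      using that cov_commute[of Y X] by (simp add: cov_add_left cov_add_right add)
    then have "w ^ 2 * exp (s * cov (\<lambda>\<omega>. X \<omega> + Y \<omega>) (\<lambda>\<omega>. X \<omega> + Y \<omega>) / 2) = exp (s * cov X Y)"
      by (simp add: w_def exp_of_nat_mult[symmetric] mult_exp_exp algebra_simps)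
    with has_bochner_integral_mult_right[of "w ^ 2", OF H[OF add[OF that(1,2)]]] show ?thesis by simp
  qed
  have h3: "has_bochner_integral M (\<lambda>\<omega>. w ^ 3 * c (X \<omega> + Y \<omega> + Z \<omega>))
      (exp (s * cov X Y) * exp (s * cov X Z) * exp (s * cov Y Z))"
    if "X \<in> L" "Y \<in> L" "Z \<in> L" "cov X X = 1" "cov Y Y = 1" "cov Z Z = 1" for X Y Z
  proof -
    let ?S = "\<lambda>\<omega>. X \<omega> + Y \<omega> + Z \<omega>"
    have "cov ?S ?S = 3 + 2 * (cov X Y + cov X Z + cov Y Z)"
      using that cov_commute[of Y X] cov_commute[of Z X] cov_commute[of Z Y]
      by (simp add: cov_add_left cov_add_right add)
    then have "w ^ 3 * exp (s * cov ?S ?S / 2) = exp (s * cov X Y) * exp (s * cov X Z) * exp (s * cov Y Z)"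
      by (simp add: w_def exp_of_nat_mult[symmetric] mult_exp_exp algebra_simps add_divide_distrib)
    with has_bochner_integral_mult_right[of "w ^ 3", OF H[OF add[OF add[OF that(1,2)] that(3)]]]
    show ?thesis by simp
  qed
  have h4: "has_bochner_integral M (\<lambda>\<omega>. w ^ 4 * c (X1 \<omega> + X2 \<omega> + X3 \<omega> + X4 \<omega>))
      (exp (s * cov X1 X2) * exp (s * cov X1 X3) * exp (s * cov X1 X4)
        * exp (s * cov X2 X3) * exp (s * cov X2 X4) * exp (s * cov X3 X4))"
  proof -
    let ?S = "\<lambda>\<omega>. X1 \<omega> + X2 \<omega> + X3 \<omega> + X4 \<omega>"
    have "cov ?S ?S = 4 + 2 * (cov X1 X2 + cov X1 X3 + cov X1 X4 + cov X2 X3 + cov X2 X4 + cov X3 X4)"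
      using L unit cov_commute[of X2 X1] cov_commute[of X3 X1] cov_commute[of X4 X1]
        cov_commute[of X3 X2] cov_commute[of X4 X2] cov_commute[of X4 X3]
      by (simp add: cov_add_left cov_add_right add)
    then have "w ^ 4 * exp (s * cov ?S ?S / 2) = exp (s * cov X1 X2) * exp (s * cov X1 X3) *
        exp (s * cov X1 X4) * exp (s * cov X2 X3) * exp (s * cov X2 X4) * exp (s * cov X3 X4)"
      by (simp add: w_def exp_of_nat_mult[symmetric] mult_exp_exp algebra_simps add_divide_distrib)
    with has_bochner_integral_mult_right[of "w ^ 4", OF H[OF add[OF add[OF add[OF L(1,2)] L(3)] L(4)]]]
    show ?thesis by simp
  qed
  have one: "has_bochner_integral M (\<lambda>_. 1 :: real) 1"
    by (simp add: has_bochner_integral_iff prob_space)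
  have "has_bochner_integral M (\<lambda>\<omega>. inclusion_exclusion c w (X1 \<omega>) (X2 \<omega>) (X3 \<omega>) (X4 \<omega>))
    (exp (s * cov X1 X2) * exp (s * cov X1 X3) * exp (s * cov X1 X4)
        * exp (s * cov X2 X3) * exp (s * cov X2 X4) * exp (s * cov X3 X4)
     - (exp (s * cov X1 X2) * exp (s * cov X1 X3) * exp (s * cov X2 X3)
      + exp (s * cov X1 X2) * exp (s * cov X1 X4) * exp (s * cov X2 X4)
      + exp (s * cov X1 X3) * exp (s * cov X1 X4) * exp (s * cov X3 X4)
      + exp (s * cov X2 X3) * exp (s * cov X2 X4) * exp (s * cov X3 X4))
     + (exp (s * cov X1 X2) + exp (s * cov X1 X3) + exp (s * cov X1 X4)
        + exp (s * cov X2 X3) + exp (s * cov X2 X4) + exp (s * cov X3 X4))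
     - (1 + 1 + 1 + 1) + 1)"
    unfolding inclusion_exclusion_def distrib_left
    by (intro has_bochner_integral_add has_bochner_integral_diff h1 h2 h3 h4 one L unit)
  moreover have "e1 - e2 + e3 - (1 + 1 + 1 + 1) + 1 = e1 - e2 + e3 - 3" for e1 e2 e3 :: real by simp
  ultimately show ?thesis unfolding alternating_sum_def w_def by (simp only:)
qed

text \<open>Changing the sign of a variable changes its correlations only by a sign, so one bound on
  \<^const>\<open>alternating_sum\<close> in terms of absolute correlations covers all eight summands of the sign
  average.\<close>

lemma fourth_moment_bound:
  assumes c: "gaussian_dalembert c s"
    and L: "X1 \<in> L" "X2 \<in> L" "X3 \<in> L" "X4 \<in> L"
    and unit: "cov X1 X1 = 1" "cov X2 X2 = 1" "cov X3 X3 = 1" "cov X4 X4 = 1"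
  defines "D \<equiv> \<lambda>y. exp (- s / 2) * c y - 1"
  shows "integrable M (\<lambda>\<omega>. D (X1 \<omega>) * D (X2 \<omega>) * D (X3 \<omega>) * D (X4 \<omega>))" (is ?int)
    and "\<bar>expectation (\<lambda>\<omega>. D (X1 \<omega>) * D (X2 \<omega>) * D (X3 \<omega>) * D (X4 \<omega>))\<bar>
      \<le> (\<bar>s\<bar> * exp \<bar>s\<bar>)\<^sup>2 * (1 + 2 * (\<bar>s\<bar> * exp \<bar>s\<bar>)) ^ 4
        * edge_sum (cov X1 X2) (cov X1 X3) (cov X1 X4) (cov X2 X3) (cov X2 X4) (cov X3 X4)"
      (is "_ \<le> ?K * ?E")
proof -
  have r1: "\<bar>cov X Y\<bar> \<le> 1" if "X \<in> L" "Y \<in> L" "cov X X = 1" "cov Y Y = 1" for X Y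
  proof -
    have "\<bar>cov X Y\<bar> \<le> expectation (\<lambda>\<omega>. (X \<omega> * X \<omega> + Y \<omega> * Y \<omega>) / 2)"
    proof (rule integral_abs_bound[THEN order_trans], rule integral_mono)
      show "\<bar>X \<omega> * Y \<omega>\<bar> \<le> (X \<omega> * X \<omega> + Y \<omega> * Y \<omega>) / 2" for \<omega>
        using sum_squares_bound[of "\<bar>X \<omega>\<bar>" "\<bar>Y \<omega>\<bar>"]
        unfolding abs_mult power2_abs by (simp add: power2_eq_square)
    qed (use that product_integrable in auto)
    also have "\<dots> = 1" using that product_integrable by simp
    finally show ?thesis .
  qed
  define I where "I = (\<lambda>X1 X2 X3 X4 \<omega>.
    inclusion_exclusion c (exp (- s / 2)) ((X1 :: 'a \<Rightarrow> real) \<omega>) (X2 \<omega>) (X3 \<omega>) (X4 \<omega>))"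
  have I: "integrable M (I Y1 Y2 Y3 Y4) \<and> \<bar>expectation (I Y1 Y2 Y3 Y4)\<bar> \<le> ?K * ?E"
    if Y: "Y1 \<in> {X1, \<lambda>\<omega>. - X1 \<omega>}" "Y2 \<in> {X2, \<lambda>\<omega>. - X2 \<omega>}"
      "Y3 \<in> {X3, \<lambda>\<omega>. - X3 \<omega>}" "Y4 \<in> {X4, \<lambda>\<omega>. - X4 \<omega>}" for Y1 Y2 Y3 Y4
  proof -
    have YL: "Y1 \<in> L" "Y2 \<in> L" "Y3 \<in> L" "Y4 \<in> L" using Y L minus by auto
    have Yu: "cov Y1 Y1 = 1" "cov Y2 Y2 = 1" "cov Y3 Y3 = 1" "cov Y4 Y4 = 1"
      using Y unit by auto
    have Ya: "\<bar>cov Y1 Y2\<bar> = \<bar>cov X1 X2\<bar>" "\<bar>cov Y1 Y3\<bar> = \<bar>cov X1 X3\<bar>" "\<bar>cov Y1 Y4\<bar> = \<bar>cov X1 X4\<bar>"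
      "\<bar>cov Y2 Y3\<bar> = \<bar>cov X2 X3\<bar>" "\<bar>cov Y2 Y4\<bar> = \<bar>cov X2 X4\<bar>" "\<bar>cov Y3 Y4\<bar> = \<bar>cov X3 X4\<bar>"
      using Y by auto
    note H = has_bochner_integral_inclusion_exclusion[OF c YL Yu]
    note R = r1[OF YL(1) YL(2) Yu(1) Yu(2)] r1[OF YL(1) YL(3) Yu(1) Yu(3)]
      r1[OF YL(1) YL(4) Yu(1) Yu(4)] r1[OF YL(2) YL(3) Yu(2) Yu(3)]
      r1[OF YL(2) YL(4) Yu(2) Yu(4)] r1[OF YL(3) YL(4) Yu(3) Yu(4)]
    have "\<bar>expectation (I Y1 Y2 Y3 Y4)\<bar> \<le> ?K * edge_sum (cov Y1 Y2) (cov Y1 Y3) (cov Y1 Y4)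
        (cov Y2 Y3) (cov Y2 Y4) (cov Y3 Y4)"
      using abs_alternating_sum_le[OF R[THEN abs_exp_minus_one_le, of s] R] H
      by (simp add: I_def has_bochner_integral_iff)
    also have "\<dots> = ?K * ?E" unfolding edge_sum_def abs_mult Ya ..
    finally show ?thesis using H by (simp add: I_def has_bochner_integral_iff)
  qed
  let ?m = "\<lambda>X \<omega>. - X \<omega> :: real"
  have eq: "(\<lambda>\<omega>. D (X1 \<omega>) * D (X2 \<omega>) * D (X3 \<omega>) * D (X4 \<omega>)) = (\<lambda>\<omega>.
      (I X1 X2 X3 X4 \<omega> + I X1 X2 X3 (?m X4) \<omega> + I X1 X2 (?m X3) X4 \<omega> + I X1 X2 (?m X3) (?m X4) \<omega>
     + I X1 (?m X2) X3 X4 \<omega> + I X1 (?m X2) X3 (?m X4) \<omega> + I X1 (?m X2) (?m X3) X4 \<omega>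
     + I X1 (?m X2) (?m X3) (?m X4) \<omega>) / 8)"
    unfolding D_def I_def by (rule ext) (rule gaussian_dalembert.prod4_eq_sign_average[OF c])
  have J: "integrable M (I X1 X2 X3 X4)" "integrable M (I X1 X2 X3 (?m X4))"
    "integrable M (I X1 X2 (?m X3) X4)" "integrable M (I X1 X2 (?m X3) (?m X4))"
    "integrable M (I X1 (?m X2) X3 X4)" "integrable M (I X1 (?m X2) X3 (?m X4))"
    "integrable M (I X1 (?m X2) (?m X3) X4)" "integrable M (I X1 (?m X2) (?m X3) (?m X4))"
    by (simp_all add: I)
  have K: "\<bar>expectation (I X1 X2 X3 X4)\<bar> \<le> ?K * ?E" "\<bar>expectation (I X1 X2 X3 (?m X4))\<bar> \<le> ?K * ?E"
    "\<bar>expectation (I X1 X2 (?m X3) X4)\<bar> \<le> ?K * ?E" "\<bar>expectation (I X1 X2 (?m X3) (?m X4))\<bar> \<le> ?K * ?E"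
    "\<bar>expectation (I X1 (?m X2) X3 X4)\<bar> \<le> ?K * ?E" "\<bar>expectation (I X1 (?m X2) X3 (?m X4))\<bar> \<le> ?K * ?E"
    "\<bar>expectation (I X1 (?m X2) (?m X3) X4)\<bar> \<le> ?K * ?E" 
    "\<bar>expectation (I X1 (?m X2) (?m X3) (?m X4))\<bar> \<le> ?K * ?E"
    using I by blast+
  show ?int unfolding eq
    by (intro integrable_divide Bochner_Integration.integrable_add J)
  have avg: "\<bar>(a1 + a2 + a3 + a4 + a5 + a6 + a7 + a8) / 8\<bar> \<le> B"
    if "\<bar>a1\<bar> \<le> B" "\<bar>a2\<bar> \<le> B" "\<bar>a3\<bar> \<le> B" "\<bar>a4\<bar> \<le> B" "\<bar>a5\<bar> \<le> B" "\<bar>a6\<bar> \<le> B" "\<bar>a7\<bar> \<le> B" "\<bar>a8\<bar> \<le> B"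
    for a1 a2 a3 a4 a5 a6 a7 a8 B :: real
  proof -
    have "\<bar>a1 + a2 + a3 + a4 + a5 + a6 + a7 + a8\<bar> \<le> B + B + B + B + B + B + B + B"
      by (intro order_trans[OF abs_triangle_ineq] add_mono that)
    then show ?thesis by simp
  qed
  have ex: "expectation (\<lambda>\<omega>. D (X1 \<omega>) * D (X2 \<omega>) * D (X3 \<omega>) * D (X4 \<omega>)) =
    (expectation (I X1 X2 X3 X4) + expectation (I X1 X2 X3 (?m X4))
     + expectation (I X1 X2 (?m X3) X4) + expectation (I X1 X2 (?m X3) (?m X4))
     + expectation (I X1 (?m X2) X3 X4) + expectation (I X1 (?m X2) X3 (?m X4))
     + expectation (I X1 (?m X2) (?m X3) X4) + expectation (I X1 (?m X2) (?m X3) (?m X4))) / 8"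
    unfolding eq using J by simp
  show "\<bar>expectation (\<lambda>\<omega>. D (X1 \<omega>) * D (X2 \<omega>) * D (X3 \<omega>) * D (X4 \<omega>))\<bar> \<le> ?K * ?E"
    unfolding ex by (rule avg[OF K])
qed

end

section \<open>Fourth moments of weighted sums and almost sure convergence\<close>

text \<open>Two disjoint edges give two independent double sums, each at most \<open>n * R\<close>. Two edges with a
  common vertex give \<open>R\<^sup>2\<close> once that vertex is fixed, and the fourth index ranges freely.\<close>

lemma quadruple_sum_edge_sum_le:
  fixes r :: "nat \<Rightarrow> nat \<Rightarrow> real"
  assumes sym: "\<And>i j. i < n \<Longrightarrow> j < n \<Longrightarrow> r i j = r j i"
    and row: "\<And>i. i < n \<Longrightarrow> (\<Sum>j<n. \<bar>r i j\<bar>) \<le> R"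
  shows "(\<Sum>i<n. \<Sum>j<n. \<Sum>k<n. \<Sum>l<n. edge_sum (r i j) (r i k) (r i l) (r j k) (r j l) (r k l))
    \<le> 7 * R\<^sup>2 * (real n)\<^sup>2"
proof (cases "n = 0")
  case False
  define a where "a = (\<lambda>i j. \<bar>r i j\<bar>)"
  define S where "S = (\<lambda>i. \<Sum>j<n. a i j)"
  have a0: "0 \<le> a i j" for i j by (simp add: a_def)
  have S: "S i \<le> R" if "i < n" for i using row[OF that] by (simp add: S_def a_def)
  have S0: "0 \<le> S i" for i by (simp add: S_def sum_nonneg a0)
  have R0: "0 \<le> R" using S[of 0] S0[of 0] False by simp
  have SS: "S i * S j \<le> R\<^sup>2" if "i < n" "j < n" for i j
    unfolding power2_eq_square by (intro mult_mono S S0 R0 that)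
  have aS: "(\<Sum>j<n. a i j * S j) \<le> R\<^sup>2" if "i < n" for i
  proof -
    have "(\<Sum>j<n. a i j * S j) \<le> (\<Sum>j<n. a i j * R)"
      by (intro sum_mono mult_left_mono S a0) auto
    also have "\<dots> = S i * R" by (simp add: S_def sum_distrib_right)
    also have "\<dots> \<le> R * R" using S[OF that] R0 by (intro mult_right_mono) auto
    finally show ?thesis by (simp add: power2_eq_square)
  qed
  have const: "(\<Sum>i<n. f i) \<le> real n * B" if "\<And>i. i < n \<Longrightarrow> f i \<le> B" for f :: "nat \<Rightarrow> real" and B
    using sum_bounded_above[of "{..<n}" f B] that by simp
  have two: "(\<Sum>i<n. \<Sum>j<n. f i j) \<le> R\<^sup>2 * (real n)\<^sup>2"
    if "\<And>i j. i < n \<Longrightarrow> j < n \<Longrightarrow> f i j \<le> R\<^sup>2" for f :: "nat \<Rightarrow> nat \<Rightarrow> real"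
    using const[OF const[OF that]] by (simp add: power2_eq_square mult_ac)
  have one: "(\<Sum>i<n. real n * f i) \<le> R\<^sup>2 * (real n)\<^sup>2"
    if "\<And>i. i < n \<Longrightarrow> f i \<le> R\<^sup>2" for f :: "nat \<Rightarrow> real"
    using const[of "\<lambda>i. real n * f i" "real n * R\<^sup>2"] that
    by (simp add: power2_eq_square mult_ac mult_left_mono)
  have t1: "(\<Sum>i<n. \<Sum>j<n. \<Sum>k<n. \<Sum>l<n. a i j * a k l) \<le> R\<^sup>2 * (real n)\<^sup>2"
  proof -
    have "(\<Sum>i<n. \<Sum>j<n. \<Sum>k<n. \<Sum>l<n. a i j * a k l) = (\<Sum>i<n. \<Sum>k<n. S i * S k)"
      unfolding S_def sum_product
      by (rule sum.cong[OF refl]) (rule sum.swap)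
    then show ?thesis using two[of "\<lambda>i k. S i * S k", OF SS] by simp
  qed
  have t2: "(\<Sum>i<n. \<Sum>j<n. \<Sum>k<n. \<Sum>l<n. a i k * a j l) \<le> R\<^sup>2 * (real n)\<^sup>2"
    using two[of "\<lambda>i j. S i * S j", OF SS] by (simp add: S_def sum_product)
  have t3: "(\<Sum>i<n. \<Sum>j<n. \<Sum>k<n. \<Sum>l<n. a i l * a j k) \<le> R\<^sup>2 * (real n)\<^sup>2"
  proof -
    have "(\<Sum>k<n. \<Sum>l<n. a i l * a j k) = S j * S i" for i j
      unfolding S_def sum_product by (intro sum.cong refl mult.commute)
    then show ?thesis using two[of "\<lambda>i j. S j * S i", OF SS] by simp
  qed
  have t4: "(\<Sum>i<n. \<Sum>j<n. \<Sum>k<n. \<Sum>l<n. a i j * a i k) \<le> R\<^sup>2 * (real n)\<^sup>2"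
  proof -
    have "(\<Sum>j<n. \<Sum>k<n. \<Sum>l<n. a i j * a i k) = real n * (S i * S i)" for i
      unfolding S_def unfolding sum_product unfolding sum_distrib_left by simp
    then show ?thesis using one[of "\<lambda>i. S i * S i", OF SS] by simp
  qed
  have t5: "(\<Sum>i<n. \<Sum>j<n. \<Sum>k<n. \<Sum>l<n. a i j * a j k) \<le> R\<^sup>2 * (real n)\<^sup>2"
  proof -
    have "(\<Sum>j<n. \<Sum>k<n. \<Sum>l<n. a i j * a j k) = real n * (\<Sum>j<n. a i j * S j)" for i
      by (simp add: S_def sum_distrib_left)
    then show ?thesis using one[of "\<lambda>i. \<Sum>j<n. a i j * S j", OF aS] by simp
  qed
  have aa: "(\<Sum>j<n. \<Sum>k<n. a i k * a j k) = (\<Sum>k<n. a i k * S k)" for i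
  proof -
    have "(\<Sum>j<n. \<Sum>k<n. a i k * a j k) = (\<Sum>j<n. \<Sum>k<n. a i k * a k j)"
      by (intro sum.cong refl) (simp add: a_def sym)
    also have "\<dots> = (\<Sum>k<n. \<Sum>j<n. a i k * a k j)" by (rule sum.swap)
    finally show ?thesis by (simp add: S_def sum_distrib_left)
  qed
  have t6: "(\<Sum>i<n. \<Sum>j<n. \<Sum>k<n. \<Sum>l<n. a i k * a j k) \<le> R\<^sup>2 * (real n)\<^sup>2"
    using one[of "\<lambda>i. \<Sum>k<n. a i k * S k", OF aS] by (simp add: aa[symmetric] sum_distrib_left)
  have t7: "(\<Sum>i<n. \<Sum>j<n. \<Sum>k<n. \<Sum>l<n. a i l * a j l) \<le> R\<^sup>2 * (real n)\<^sup>2"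
    using one[of "\<lambda>i. \<Sum>k<n. a i k * S k", OF aS] by (simp add: aa[symmetric] sum_distrib_left)
  have "(\<Sum>i<n. \<Sum>j<n. \<Sum>k<n. \<Sum>l<n. edge_sum (r i j) (r i k) (r i l) (r j k) (r j l) (r k l)) =
    (\<Sum>i<n. \<Sum>j<n. \<Sum>k<n. \<Sum>l<n. a i j * a k l) + (\<Sum>i<n. \<Sum>j<n. \<Sum>k<n. \<Sum>l<n. a i k * a j l) +
    (\<Sum>i<n. \<Sum>j<n. \<Sum>k<n. \<Sum>l<n. a i l * a j k) + (\<Sum>i<n. \<Sum>j<n. \<Sum>k<n. \<Sum>l<n. a i j * a i k) +
    (\<Sum>i<n. \<Sum>j<n. \<Sum>k<n. \<Sum>l<n. a i j * a j k) + (\<Sum>i<n. \<Sum>j<n. \<Sum>k<n. \<Sum>l<n. a i k * a j k) +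
    (\<Sum>i<n. \<Sum>j<n. \<Sum>k<n. \<Sum>l<n. a i l * a j l)"
    unfolding edge_sum_def abs_mult a_def by (simp only: sum.distrib)
  with t1 t2 t3 t4 t5 t6 t7 show ?thesis by linarith
qed simp

lemma power4_sum:
  fixes f :: "nat \<Rightarrow> real"
  shows "(\<Sum>i<n. f i) ^ 4 = (\<Sum>i<n. \<Sum>j<n. \<Sum>k<n. \<Sum>l<n. f i * f j * f k * f l)"
  by (simp only: power4_eq_xxxx sum_distrib_left[symmetric] sum_distrib_right[symmetric])

context centered_gaussian_space
begin

lemma weighted_sum_fourth_moment:
  assumes c: "gaussian_dalembert c s"
    and L: "\<And>k. k < n \<Longrightarrow> Y k \<in> L"
    and unit: "\<And>k. k < n \<Longrightarrow> cov (Y k) (Y k) = 1"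
    and row: "\<And>i. i < n \<Longrightarrow> (\<Sum>j<n. \<bar>cov (Y i) (Y j)\<bar>) \<le> R"
    and b: "\<And>k. k < n \<Longrightarrow> \<bar>b k\<bar> \<le> 1"
  defines "S \<equiv> \<lambda>\<omega>. \<Sum>k<n. b k * (exp (- s / 2) * c (Y k \<omega>) - 1)"
  shows "integrable M (\<lambda>\<omega>. S \<omega> ^ 4)"
    and "expectation (\<lambda>\<omega>. S \<omega> ^ 4)
      \<le> (\<bar>s\<bar> * exp \<bar>s\<bar>)\<^sup>2 * (1 + 2 * (\<bar>s\<bar> * exp \<bar>s\<bar>)) ^ 4 * (7 * R\<^sup>2) * (real n)\<^sup>2"
proof -
  define K where "K = (\<bar>s\<bar> * exp \<bar>s\<bar>)\<^sup>2 * (1 + 2 * (\<bar>s\<bar> * exp \<bar>s\<bar>)) ^ 4"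
  have K0: "0 \<le> K" by (simp add: K_def)
  define D where "D = (\<lambda>k \<omega>. exp (- s / 2) * c (Y k \<omega>) - 1)"
  define r where "r = (\<lambda>i j. cov (Y i) (Y j))"
  note F = fourth_moment_bound[OF c L L L L unit unit unit unit]
  have int: "integrable M (\<lambda>\<omega>. D i \<omega> * D j \<omega> * D k \<omega> * D l \<omega>)"
    if "i < n" "j < n" "k < n" "l < n" for i j k l
    unfolding D_def by (rule F(1)) (use that in auto)
  have bnd: "\<bar>expectation (\<lambda>\<omega>. D i \<omega> * D j \<omega> * D k \<omega> * D l \<omega>)\<bar>
      \<le> K * edge_sum (r i j) (r i k) (r i l) (r j k) (r j l) (r k l)"
    if "i < n" "j < n" "k < n" "l < n" for i j k l
    unfolding D_def K_def r_def by (rule F(2)) (use that in auto)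
  have S4: "S \<omega> ^ 4 = (\<Sum>i<n. \<Sum>j<n. \<Sum>k<n. \<Sum>l<n.
      (b i * b j * b k * b l) * (D i \<omega> * D j \<omega> * D k \<omega> * D l \<omega>))" for \<omega>
    unfolding S_def D_def power4_sum by (simp only: mult_ac)
  have S: "has_bochner_integral M (\<lambda>\<omega>. S \<omega> ^ 4) (\<Sum>i<n. \<Sum>j<n. \<Sum>k<n. \<Sum>l<n.
      (b i * b j * b k * b l) * expectation (\<lambda>\<omega>. D i \<omega> * D j \<omega> * D k \<omega> * D l \<omega>))"
    unfolding S4
    by (intro has_bochner_integral_sum has_bochner_integral_mult_right
        has_bochner_integral_integrable int) auto
  then show "integrable M (\<lambda>\<omega>. S \<omega> ^ 4)" by (simp add: has_bochner_integral_iff)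
  have "expectation (\<lambda>\<omega>. S \<omega> ^ 4) = (\<Sum>i<n. \<Sum>j<n. \<Sum>k<n. \<Sum>l<n.
      (b i * b j * b k * b l) * expectation (\<lambda>\<omega>. D i \<omega> * D j \<omega> * D k \<omega> * D l \<omega>))"
    by (rule has_bochner_integral_integral_eq[OF S])
  also have "\<dots> \<le> (\<Sum>i<n. \<Sum>j<n. \<Sum>k<n. \<Sum>l<n.
      K * edge_sum (r i j) (r i k) (r i l) (r j k) (r j l) (r k l))"
  proof (intro sum_mono)
    fix i j k l assume ijkl: "i \<in> {..<n}" "j \<in> {..<n}" "k \<in> {..<n}" "l \<in> {..<n}"
    let ?E = "expectation (\<lambda>\<omega>. D i \<omega> * D j \<omega> * D k \<omega> * D l \<omega>)"
    have "\<bar>b i * b j * b k * b l\<bar> \<le> 1 * 1 * 1 * 1"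
      unfolding abs_mult by (intro mult_mono b mult_nonneg_nonneg) (use ijkl in auto)
    then have "\<bar>(b i * b j * b k * b l) * ?E\<bar> \<le> \<bar>?E\<bar>"
      unfolding abs_mult[of "b i * b j * b k * b l"] by (intro mult_left_le_one_le) auto
    with bnd[of i j k l] ijkl show "(b i * b j * b k * b l) * ?E
        \<le> K * edge_sum (r i j) (r i k) (r i l) (r j k) (r j l) (r k l)"
      unfolding lessThan_iff by linarith
  qed
  also have "\<dots> = K * (\<Sum>i<n. \<Sum>j<n. \<Sum>k<n. \<Sum>l<n.
      edge_sum (r i j) (r i k) (r i l) (r j k) (r j l) (r k l))"
    by (simp only: sum_distrib_left)
  also have "\<dots> \<le> K * (7 * R\<^sup>2 * (real n)\<^sup>2)"
    using row by (intro mult_left_mono quadruple_sum_edge_sum_le K0)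
      (auto simp: r_def intro: cov_commute)
  finally show "expectation (\<lambda>\<omega>. S \<omega> ^ 4)
      \<le> (\<bar>s\<bar> * exp \<bar>s\<bar>)\<^sup>2 * (1 + 2 * (\<bar>s\<bar> * exp \<bar>s\<bar>)) ^ 4 * (7 * R\<^sup>2) * (real n)\<^sup>2"
    by (simp add: K_def mult_ac)
qed

end

text \<open>The expected sum of the fourth powers is finite, so the sum is almost surely finite and its terms tend
  to \<open>0\<close>. Second moments of order \<open>1 / n\<close> would not be summable.\<close>

lemma AE_tendsto_zero_of_fourth_moments:
  fixes S :: "nat \<Rightarrow> 'a \<Rightarrow> real"
  assumes int: "\<And>n. integrable M (\<lambda>\<omega>. S n \<omega> ^ 4)"
    and le: "\<And>n. 0 < n \<Longrightarrow> (\<integral>\<omega>. S n \<omega> ^ 4 \<partial>M) \<le> C / (real n)\<^sup>2"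
  shows "AE \<omega> in M. (\<lambda>n. S n \<omega>) \<longlonglongrightarrow> 0"
proof -
  \<comment> \<open>The index starts at 1, where the moment bound holds.\<close>
  let ?f = "\<lambda>n \<omega>. ennreal (S (Suc n) \<omega> ^ 4)"
  have meas: "?f n \<in> borel_measurable M" for n
    using int[of "Suc n"] by (intro measurable_compose[OF _ measurable_ennreal]) auto
  have sm: "summable (\<lambda>n. C / (real (Suc n))\<^sup>2)"
    using summable_mult[OF inverse_power_summable[of 2, THEN summable_Suc_iff[THEN iffD2]], where c = C]
    by (simp add: divide_inverse)
  have C0: "0 \<le> C"
  proof -
    have "0 \<le> (\<integral>\<omega>. S 1 \<omega> ^ 4 \<partial>M)" by (intro integral_nonneg_AE) auto
    also have "\<dots> \<le> C" using le[of 1] by simp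
    finally show ?thesis .
  qed
  have "(\<integral>\<^sup>+\<omega>. (\<Sum>n. ?f n \<omega>) \<partial>M) = (\<Sum>n. \<integral>\<^sup>+\<omega>. ?f n \<omega> \<partial>M)"
    by (rule nn_integral_suminf) (rule meas)
  also have "\<dots> \<le> (\<Sum>n. ennreal (C / (real (Suc n))\<^sup>2))"
  proof (intro suminf_le)
    show "(\<integral>\<^sup>+\<omega>. ?f n \<omega> \<partial>M) \<le> ennreal (C / (real (Suc n))\<^sup>2)" for n
      using le[of "Suc n"] by (subst nn_integral_eq_integral[OF int]) (auto intro!: ennreal_leI)
  qed auto
  also have "\<dots> = ennreal (\<Sum>n. C / (real (Suc n))\<^sup>2)"
    using C0 by (intro suminf_ennreal_eq summable_sums sm) auto
  also have "\<dots> < \<infinity>" by simp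
  finally have "(\<integral>\<^sup>+\<omega>. (\<Sum>n. ?f n \<omega>) \<partial>M) \<noteq> \<infinity>" by simp
  then have "AE \<omega> in M. (\<Sum>n. ?f n \<omega>) \<noteq> \<infinity>"
    by (intro nn_integral_PInf_AE borel_measurable_suminf_order) (use meas in auto)
  then show ?thesis
  proof eventually_elim
    case (elim \<omega>)
    then have "summable (\<lambda>n. S (Suc n) \<omega> ^ 4)"
      by (intro summable_suminf_not_top) auto
    then have "(\<lambda>n. S n \<omega> ^ 4) \<longlonglongrightarrow> 0"
      using summable_LIMSEQ_zero filterlim_sequentially_Suc[of "\<lambda>n. S n \<omega> ^ 4"] by blast
    then have "(\<lambda>n. root 4 (S n \<omega> ^ 4)) \<longlonglongrightarrow> root 4 0" by (rule tendsto_real_root)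
    moreover have "root 4 (S n \<omega> ^ 4) = \<bar>S n \<omega>\<bar>" for n
      using real_root_power_cancel[of 4 "\<bar>S n \<omega>\<bar>"] by (simp add: power_even_abs)
    ultimately show ?case by (simp add: tendsto_rabs_zero_iff)
  qed
qed

section \<open>Increments of fractional Brownian motion\<close>

text \<open>The autocovariance of fractional Gaussian noise at lag \<open>d\<close>, with \<open>q\<close> twice the Hurst parameter.\<close>

definition fgn_cov :: "real \<Rightarrow> real \<Rightarrow> real" where
  "fgn_cov q d = (\<bar>d + 1\<bar> powr q + \<bar>d - 1\<bar> powr q - 2 * \<bar>d\<bar> powr q) / 2"

text \<open>The second difference of the concave function \<open>t powr q\<close>. Comparing the first
  differences at \<open>e - 1\<close> and \<open>e\<close> covers the case \<open>e = 1\<close>, where the derivative at the left end point is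
  infinite.\<close>

lemma fgn_cov_nonpos:
  assumes q: "0 < q" "q \<le> 1" and d: "1 \<le> \<bar>d\<bar>"
  shows "fgn_cov q d \<le> 0"
proof -
  have nonpos: "(e + 1) powr q + (e - 1) powr q - 2 * e powr q \<le> 0" if e: "1 \<le> e" for e :: real
  proof -
    define \<phi> where "\<phi> = (\<lambda>t::real. (t + 1) powr q - t powr q)"
    have "\<phi> e \<le> \<phi> (e - 1)"
    proof (rule DERIV_nonpos_imp_decreasing_open[of "e - 1" e \<phi>])
      show "continuous_on {e - 1..e} \<phi>" unfolding \<phi>_def
        by (intro continuous_intros continuous_on_powr') (use e q in auto)
      fix t assume t: "e - 1 < t" "t < e"
      then have t0: "0 < t" using e by simp
      have "(\<phi> has_real_derivative (q * (t + 1) powr (q - 1) - q * t powr (q - 1))) (at t)"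
        unfolding \<phi>_def using t0 by (auto intro!: derivative_eq_intros)
      moreover have "q * (t + 1) powr (q - 1) - q * t powr (q - 1) \<le> 0"
        using q t0 powr_mono2'[of "q - 1" t "t + 1"] by simp
      ultimately show "\<exists>y. (\<phi> has_real_derivative y) (at t) \<and> y \<le> 0" by blast
    qed simp
    then show ?thesis by (simp add: \<phi>_def)
  qed
  have "\<bar>d + 1\<bar> = \<bar>d\<bar> + 1 \<and> \<bar>d - 1\<bar> = \<bar>d\<bar> - 1 \<or> \<bar>d + 1\<bar> = \<bar>d\<bar> - 1 \<and> \<bar>d - 1\<bar> = \<bar>d\<bar> + 1"
    using d by linarith
  then show ?thesis
    using nonpos[OF d] by (auto simp: fgn_cov_def)
qed

text \<open>Only the diagonal term, equal to \<open>1\<close>, is positive, so the sum of absolute values is \<open>2\<close> minus the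
  plain sum. The plain sum telescopes to the covariance of one increment with the total increment over
  the whole interval, which is nonnegative.\<close>

lemma sum_abs_fgn_cov_le:
  assumes q: "0 < q" "q \<le> 1" and i: "i < n"
  shows "(\<Sum>j<n. \<bar>fgn_cov q (real i - real j)\<bar>) \<le> 2"
proof -
  let ?r = "\<lambda>j. fgn_cov q (real i - real j)"
  \<comment> \<open>The second difference is a difference of first differences.\<close>
  define F where "F = (\<lambda>j::nat. \<bar>real i - real j + 1\<bar> powr q - \<bar>real i - real j\<bar> powr q)"
  have r: "?r j = (F j - F (Suc j)) / 2" for j
    by (simp add: fgn_cov_def F_def algebra_simps)
  have "(\<Sum>j<n. ?r j) = (F 0 - F n) / 2"
    unfolding r sum_divide_distrib[symmetric] by (simp add: sum_lessThan_telescope')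
  moreover have "0 \<le> F 0" using q by (simp add: F_def powr_mono2)
  moreover have "F n \<le> 0" using q i by (simp add: F_def powr_mono2)
  ultimately have nonneg: "0 \<le> (\<Sum>j<n. ?r j)" by simp
  have diag: "?r i = 1" using q by (simp add: fgn_cov_def)
  have "(\<Sum>j<n. \<bar>?r j\<bar>) = (\<Sum>j<n. (if j = i then 2 else 0) - ?r j)"
  proof (intro sum.cong refl)
    fix j show "\<bar>?r j\<bar> = (if j = i then 2 else 0) - ?r j"
      using diag fgn_cov_nonpos[OF q, of "real i - real j"] by (cases "j = i") (auto split: if_splits)
  qed
  also have "\<dots> = 2 - (\<Sum>j<n. ?r j)" using i by (simp add: sum_subtractf)
  finally show ?thesis using nonneg by simp
qed

text \<open>A vanishing integral does not by itself entail integrability, which is what lets the expectation pass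
  through linear combinations of the values of the process.\<close>

lemma (in prob_space) gaussian_rv_integrable:
  assumes "gaussian_rv M X" shows "integrable M X"
proof -
  have [measurable]: "X \<in> borel_measurable M" using assms by (simp add: gaussian_rv_def)
  from assms consider \<mu> \<sigma> where "0 < \<sigma>" "distributed M lborel X (normal_density \<mu> \<sigma>)"
    | \<mu> where "AE \<omega> in M. X \<omega> = \<mu>" unfolding gaussian_rv_def by blast
  then show ?thesis
  proof cases
    case 1
    then show ?thesis
      using integrable_normal_moment_nz_1[of \<sigma> \<mu>] distributed_integrable_var[of M X "normal_density \<mu> \<sigma>"]
      by simp
  next
    case 2
    have "integrable M (\<lambda>_. \<mu>)" by simp
    then show ?thesis by (rule integrable_cong_AE_imp) (use 2 in auto)
  qed
qed

definition linear_span :: "(real \<Rightarrow> 'a \<Rightarrow> real) \<Rightarrow> ('a \<Rightarrow> real) set" where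
  "linear_span x = {X. \<exists>T a. finite T \<and> T \<subseteq> {0..1} \<and> X = (\<lambda>\<omega>. \<Sum>t\<in>T. a t * x t \<omega>)}"

lemma linear_spanI: "t \<in> {0..1} \<Longrightarrow> x t \<in> linear_span x"
  unfolding linear_span_def by (intro CollectI exI[of _ "{t}"] exI[of _ "\<lambda>_. 1"]) auto

lemma linear_span_scale:
  assumes "X \<in> linear_span x" shows "(\<lambda>\<omega>. c * X \<omega>) \<in> linear_span x"
proof -
  obtain T a where "finite T" "T \<subseteq> {0..1}" "X = (\<lambda>\<omega>. \<Sum>t\<in>T. a t * x t \<omega>)"
    using assms by (auto simp: linear_span_def)
  then show ?thesis unfolding linear_span_def
    by (intro CollectI exI[of _ T] exI[of _ "\<lambda>t. c * a t"]) (auto simp: sum_distrib_left mult.assoc)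
qed

lemma linear_span_add:
  assumes "X \<in> linear_span x" "Y \<in> linear_span x"
  shows "(\<lambda>\<omega>. X \<omega> + Y \<omega>) \<in> linear_span x"
proof -
  obtain T a where T: "finite T" "T \<subseteq> {0..1}" "X = (\<lambda>\<omega>. \<Sum>t\<in>T. a t * x t \<omega>)"
    using assms by (auto simp: linear_span_def)
  obtain U b where U: "finite U" "U \<subseteq> {0..1}" "Y = (\<lambda>\<omega>. \<Sum>t\<in>U. b t * x t \<omega>)"
    using assms by (auto simp: linear_span_def)
  let ?c = "\<lambda>t. (if t \<in> T then a t else 0) + (if t \<in> U then b t else 0)"
  have "X \<omega> + Y \<omega> = (\<Sum>t\<in>T \<union> U. ?c t * x t \<omega>)" for \<omega>
  proof -
    have "(\<Sum>t\<in>T \<union> U. (if t \<in> T then a t else 0) * x t \<omega>) = (\<Sum>t\<in>T. a t * x t \<omega>)"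
      by (rule sum.mono_neutral_cong_right) (use T U in auto)
    moreover have "(\<Sum>t\<in>T \<union> U. (if t \<in> U then b t else 0) * x t \<omega>) = (\<Sum>t\<in>U. b t * x t \<omega>)"
      by (rule sum.mono_neutral_cong_right) (use T U in auto)
    ultimately show ?thesis using T(3) U(3) by (simp add: distrib_right sum.distrib)
  qed
  then show ?thesis unfolding linear_span_def using T U
    by (intro CollectI exI[of _ "T \<union> U"] exI[of _ ?c]) auto
qed

lemma centered_gaussian_space_linear_span:
  assumes "prob_space M" and fbm: "fractional_brownian_motion M \<nu> x"
  shows "centered_gaussian_space M (linear_span x)"
proof -
  interpret prob_space M by fact
  have G: "gaussian_rv M X" if "X \<in> linear_span x" for X
    using that fbm by (auto simp: linear_span_def fractional_brownian_motion_def gaussian_process_def)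
  show ?thesis
  proof
    fix X assume X: "X \<in> linear_span x"
    then show "gaussian_rv M X" by (rule G)
    obtain T a where T: "finite T" "T \<subseteq> {0..1}" "X = (\<lambda>\<omega>. \<Sum>t\<in>T. a t * x t \<omega>)"
      using X by (auto simp: linear_span_def)
    have int: "integrable M (x t)" if "t \<in> T" for t
      using that T by (intro gaussian_rv_integrable G linear_spanI) auto
    have "has_bochner_integral M X (\<Sum>t\<in>T. a t * expectation (x t))"
      unfolding T(3) by (intro has_bochner_integral_sum has_bochner_integral_mult_right
          has_bochner_integral_integrable int)
    moreover have "(\<Sum>t\<in>T. a t * expectation (x t)) = 0"
      using T(2) fbm by (intro sum.neutral) (auto simp: fractional_brownian_motion_def)
    ultimately show "expectation X = 0" by (simp add: has_bochner_integral_iff)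
  qed (auto intro: linear_span_add linear_span_scale)
qed

definition normalized_increment ::
    "(real \<Rightarrow> 'a \<Rightarrow> real) \<Rightarrow> real \<Rightarrow> nat \<Rightarrow> nat \<Rightarrow> 'a \<Rightarrow> real" where
  "normalized_increment x \<nu> n k \<omega> =
     real n powr \<nu> * increment x (real k / real n) (real (Suc k) / real n) \<omega>"

lemma normalized_increment_in_span:
  assumes "k < n" shows "normalized_increment x \<nu> n k \<in> linear_span x"
proof -
  have "(\<lambda>\<omega>. real n powr \<nu> * (x (real (Suc k) / real n) \<omega> + (- 1) * x (real k / real n) \<omega>)) \<in> linear_span x"
    using assms by (intro linear_span_scale linear_span_add linear_spanI) auto
  then show ?thesis by (simp add: normalized_increment_def[abs_def] increment_def)
qed

lemma cov_normalized_increment: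
  assumes "prob_space M" and fbm: "fractional_brownian_motion M \<nu> x"
    and ij: "i < n" "j < n"
  shows "(\<integral>\<omega>. normalized_increment x \<nu> n i \<omega> * normalized_increment x \<nu> n j \<omega> \<partial>M)
    = fgn_cov (2 * \<nu>) (real i - real j)"
proof -
  interpret centered_gaussian_space M "linear_span x"
    using assms(1,2) by (rule centered_gaussian_space_linear_span)
  define q where "q = 2 * \<nu>"
  define t where "t = (\<lambda>k::nat. real k / real n)"
  have t: "t i \<in> {0..1}" "t (Suc i) \<in> {0..1}" "t j \<in> {0..1}" "t (Suc j) \<in> {0..1}"
    using ij by (auto simp: t_def)
  have C: "cov (x u) (x v) = (u powr q + v powr q - \<bar>v - u\<bar> powr q) / 2"
    if "u \<in> {0..1}" "v \<in> {0..1}" for u v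
    using fbm that by (auto simp: fractional_brownian_motion_def q_def)
  have I: "integrable M (\<lambda>\<omega>. x u \<omega> * x v \<omega>)" if "u \<in> {0..1}" "v \<in> {0..1}" for u v
    using that by (intro product_integrable linear_spanI)
  have n: "real n powr \<nu> * real n powr \<nu> = real n powr q"
    by (simp add: q_def powr_add[symmetric])
  have "(\<integral>\<omega>. normalized_increment x \<nu> n i \<omega> * normalized_increment x \<nu> n j \<omega> \<partial>M) =
     (\<integral>\<omega>. real n powr q * (x (t (Suc i)) \<omega> * x (t (Suc j)) \<omega> - x (t (Suc i)) \<omega> * x (t j) \<omega>
        - x (t i) \<omega> * x (t (Suc j)) \<omega> + x (t i) \<omega> * x (t j) \<omega>) \<partial>M)"
    unfolding normalized_increment_def increment_def t_def n[symmetric]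
    by (intro Bochner_Integration.integral_cong refl) algebra
  also have "\<dots> = real n powr q * (cov (x (t (Suc i))) (x (t (Suc j))) - cov (x (t (Suc i))) (x (t j))
        - cov (x (t i)) (x (t (Suc j))) + cov (x (t i)) (x (t j)))"
    using I t by simp
  also have "\<dots> = real n powr q * (\<bar>t j - t (Suc i)\<bar> powr q + \<bar>t (Suc j) - t i\<bar> powr q
      - \<bar>t (Suc j) - t (Suc i)\<bar> powr q - \<bar>t j - t i\<bar> powr q) / 2"
    unfolding C[OF t(2) t(4)] C[OF t(2) t(3)] C[OF t(1) t(4)] C[OF t(1) t(3)] by (simp add: field_simps)
  also have "\<dots> = ((real n * \<bar>t j - t (Suc i)\<bar>) powr q + (real n * \<bar>t (Suc j) - t i\<bar>) powr q
      - (real n * \<bar>t (Suc j) - t (Suc i)\<bar>) powr q - (real n * \<bar>t j - t i\<bar>) powr q) / 2"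
    by (simp add: powr_mult algebra_simps)
  also have "\<dots> = fgn_cov q (real i - real j)"
  proof -
    have s: "real n * \<bar>t k - t l\<bar> = \<bar>real l - real k\<bar>" for k l
    proof -
      have "real n * \<bar>t k - t l\<bar> = \<bar>real n * (t k - t l)\<bar>" by (simp add: abs_mult)
      also have "real n * (t k - t l) = real k - real l" using ij by (simp add: t_def field_simps)
      finally show ?thesis by simp
    qed
    show ?thesis unfolding s fgn_cov_def by (simp add: algebra_simps)
  qed
  finally show ?thesis by (simp add: q_def)
qed

text \<open>Row sums of the correlation matrix are bounded by \<open>2\<close> uniformly in \<open>n\<close>, so the fourth moment of the
  average is of order \<open>1 / n\<^sup>2\<close>. Monomial weights suffice to reach all continuous weights later, and
  there are only countably many of them.\<close>

lemma AE_dalembert_averages: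
  assumes P: "prob_space M" and \<nu>: "0 < \<nu>" "\<nu> \<le> 1 / 2"
    and fbm: "fractional_brownian_motion M \<nu> x" and c: "gaussian_dalembert c s"
  shows "AE \<omega> in M. (\<lambda>n. 1 / real n * (\<Sum>k<n. (real k / real n) ^ j *
      (c (normalized_increment x \<nu> n k \<omega>) - exp (s / 2)))) \<longlonglongrightarrow> 0"
proof -
  interpret centered_gaussian_space M "linear_span x"
    using P fbm by (rule centered_gaussian_space_linear_span)
  define S where "S = (\<lambda>n \<omega>. \<Sum>k<n. (real k / real n) ^ j *
      (exp (- s / 2) * c (normalized_increment x \<nu> n k \<omega>) - 1))"
  define C where "C = (\<bar>s\<bar> * exp \<bar>s\<bar>)\<^sup>2 * (1 + 2 * (\<bar>s\<bar> * exp \<bar>s\<bar>)) ^ 4 * (7 * 2\<^sup>2)"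
  note cov = cov_normalized_increment[OF P fbm]
  have unit: "cov (normalized_increment x \<nu> n k) (normalized_increment x \<nu> n k) = 1" if "k < n" for k n
    using \<nu> by (simp add: cov[OF that that] fgn_cov_def)
  have row: "(\<Sum>j<n. \<bar>cov (normalized_increment x \<nu> n i) (normalized_increment x \<nu> n j)\<bar>) \<le> 2"
    if "i < n" for i n
    using sum_abs_fgn_cov_le[of "2 * \<nu>" i n] \<nu> that by (simp add: cov)
  have w: "\<bar>(real k / real n) ^ j\<bar> \<le> 1" if "k < n" for k n
    using that by (simp add: power_le_one power_abs)
  note F = weighted_sum_fourth_moment[OF c normalized_increment_in_span unit row w]
  have F1: "integrable M (\<lambda>\<omega>. S n \<omega> ^ 4)" for n
    unfolding S_def by (rule F(1))
  have F2: "expectation (\<lambda>\<omega>. S n \<omega> ^ 4) \<le> C * (real n)\<^sup>2" for n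
    unfolding S_def C_def by (rule F(2))
  have "AE \<omega> in M. (\<lambda>n. 1 / real n * S n \<omega>) \<longlonglongrightarrow> 0"
  proof (rule AE_tendsto_zero_of_fourth_moments)
    show "integrable M (\<lambda>\<omega>. (1 / real n * S n \<omega>) ^ 4)" for n
      unfolding power_mult_distrib by (intro integrable_mult_right F1)
    show "(\<integral>\<omega>. (1 / real n * S n \<omega>) ^ 4 \<partial>M) \<le> C / (real n)\<^sup>2" if "0 < n" for n
    proof -
      have "(\<integral>\<omega>. (1 / real n * S n \<omega>) ^ 4 \<partial>M) = (1 / real n) ^ 4 * expectation (\<lambda>\<omega>. S n \<omega> ^ 4)"
        unfolding power_mult_distrib by (rule integral_mult_right_zero)
      also have "\<dots> \<le> (1 / real n) ^ 4 * (C * (real n)\<^sup>2)"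
        by (intro mult_left_mono F2) auto
      also have "\<dots> = C / (real n)\<^sup>2" using that by (simp add: field_simps eval_nat_numeral)
      finally show ?thesis .
    qed
  qed
  then show ?thesis
  proof eventually_elim
    case (elim \<omega>)
    have e: "exp (s / 2) * exp (- s / 2) = 1" by (simp add: mult_exp_exp)
    have eq: "1 / real n * (\<Sum>k<n. (real k / real n) ^ j *
      (c (normalized_increment x \<nu> n k \<omega>) - exp (s / 2))) = exp (s / 2) * (1 / real n * S n \<omega>)" for n
    proof -
      have pt: "v * (y - exp (s / 2)) = exp (s / 2) * (v * (exp (- s / 2) * y - 1))" for v y
        using e by algebra
      show ?thesis unfolding S_def pt sum_distrib_left[symmetric] by (rule mult.left_commute)
    qed
    show ?case unfolding eq by (rule tendsto_mult_right_zero[OF elim])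
  qed
qed

section \<open>From cosines to absolute powers\<close>

abbreviation gauss_mean :: "(real \<Rightarrow> real) \<Rightarrow> real" where
  "gauss_mean f \<equiv> (LINT u|std_normal_distribution. f u)"

text \<open>The rows of \<open>y\<close> behave, as seen by the test function \<open>f\<close> and the weight \<open>h\<close>, like samples of
  the standard normal law. In this section \<open>y\<close> is a deterministic array, to be instantiated with the normalized increments at
  one sample point.\<close>

definition averages_out :: "(nat \<Rightarrow> nat \<Rightarrow> real) \<Rightarrow> (real \<Rightarrow> real) \<Rightarrow> (real \<Rightarrow> real) \<Rightarrow> bool" where
  "averages_out y h f \<longleftrightarrow>
     (\<lambda>n. 1 / real n * (\<Sum>k<n. h (real k / real n) * (f (y n k) - gauss_mean f))) \<longlonglongrightarrow> 0"

lemma prob_space_std_normal: "prob_space std_normal_distribution"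
  using prob_space_normal_density[of 1 0] by simp

lemma averages_out_sum:
  assumes "\<And>i. i \<in> I \<Longrightarrow> averages_out y h (f i)"
    and "\<And>i. i \<in> I \<Longrightarrow> integrable std_normal_distribution (f i)"
  shows "averages_out y h (\<lambda>u. \<Sum>i\<in>I. a i * f i u)"
proof -
  have "(\<lambda>n. \<Sum>i\<in>I. a i * (1 / real n * (\<Sum>k<n. h (real k / real n) * (f i (y n k) - gauss_mean (f i)))))
      \<longlonglongrightarrow> (\<Sum>i\<in>I. a i * 0)"
    using assms(1) by (intro tendsto_sum tendsto_mult tendsto_const) (simp add: averages_out_def)
  moreover have "(\<Sum>i\<in>I. a i * (1 / real n * (\<Sum>k<n. h (real k / real n) * (f i (y n k) - gauss_mean (f i)))))
    = 1 / real n * (\<Sum>k<n. h (real k / real n) *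
        ((\<Sum>i\<in>I. a i * f i (y n k)) - gauss_mean (\<lambda>u. \<Sum>i\<in>I. a i * f i u)))" for n
  proof -
    have g: "gauss_mean (\<lambda>u. \<Sum>i\<in>I. a i * f i u) = (\<Sum>i\<in>I. a i * gauss_mean (f i))"
      using assms(2) by (simp add: Bochner_Integration.integral_sum)
    have "h (real k / real n) * ((\<Sum>i\<in>I. a i * f i (y n k)) - (\<Sum>i\<in>I. a i * gauss_mean (f i)))
        = (\<Sum>i\<in>I. a i * (h (real k / real n) * (f i (y n k) - gauss_mean (f i))))" for k
      unfolding sum_subtractf[symmetric] sum_distrib_left
      by (intro sum.cong refl) (simp add: algebra_simps)
    then have "(\<Sum>k<n. h (real k / real n) * ((\<Sum>i\<in>I. a i * f i (y n k)) - (\<Sum>i\<in>I. a i * gauss_mean (f i))))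
        = (\<Sum>i\<in>I. a i * (\<Sum>k<n. h (real k / real n) * (f i (y n k) - gauss_mean (f i))))"
      by (simp add: sum.swap[of _ I] sum_distrib_left)
    then show ?thesis unfolding g by (simp add: sum_distrib_left mult.left_commute)
  qed
  ultimately show ?thesis by (simp add: averages_out_def)
qed

lemma integrable_bounded_std_normal:
  fixes f :: "real \<Rightarrow> real"
  assumes "f \<in> borel_measurable borel" "\<And>u. \<bar>f u\<bar> \<le> B"
  shows "integrable std_normal_distribution f"
proof -
  interpret prob_space std_normal_distribution by (rule prob_space_std_normal)
  show ?thesis by (rule integrable_const_bound[where B = B]) (use assms in auto)
qed

text \<open>The products \<open>cos v ^ m * cos (l * v)\<close> are linear combinations of cosines of integer multiples of \<open>v\<close>;
  integer rather than natural \<open>l\<close> spares a case distinction when \<open>l\<close> is lowered.\<close>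

lemma averages_out_cos_power:
  assumes cos: "\<And>l::int. averages_out y h (\<lambda>u. cos (of_int l * (\<theta> * u)))"
  shows "averages_out y h (\<lambda>u. cos (\<theta> * u) ^ m * cos (of_int l * (\<theta> * u)))"
proof (induction m arbitrary: l)
  case 0
  show ?case using cos[of l] by simp
next
  case (Suc m)
  let ?f = "\<lambda>(d::int) u. cos (\<theta> * u) ^ m * cos (of_int (l + d) * (\<theta> * u))"
  have "averages_out y h (\<lambda>u. \<Sum>d\<in>{-1, 1}. 1 / 2 * ?f d u)"
  proof (rule averages_out_sum)
    show "integrable std_normal_distribution (?f d)" for d
    proof (rule integrable_bounded_std_normal[where B = 1])
      show "\<bar>?f d u\<bar> \<le> 1" for u
        unfolding abs_mult power_abs by (intro mult_le_one power_le_one) auto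
    qed measurable
  qed (rule Suc.IH)
  moreover have "(\<Sum>d\<in>{-1, 1}. 1 / 2 * ?f d u) =
      cos (\<theta> * u) ^ Suc m * cos (of_int l * (\<theta> * u))" for u
  proof -
    have p: "cos v * cos (of_int l * v) = (cos (of_int (l + (-1)) * v) + cos (of_int (l + 1) * v)) / 2" for v :: real
      unfolding cos_times_cos[of v "of_int l * v"] using cos_minus[of "of_int (l + (-1)) * v"]
      by (simp add: algebra_simps)
    have "(\<Sum>d\<in>{-1, 1}. 1 / 2 * ?f d u) = cos (\<theta> * u) ^ m *
        ((cos (of_int (l + (-1)) * (\<theta> * u)) + cos (of_int (l + 1) * (\<theta> * u))) / 2)"
      by (simp add: field_simps)
    then show ?thesis unfolding p[symmetric] by (simp add: mult_ac)
  qed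
  ultimately show ?case by simp
qed

lemma cosh_dominates_powr:
  fixes p :: real
  assumes "0 < \<epsilon>" 
  obtains K :: nat where "1 \<le> K" "\<And>u. real K \<le> \<bar>u\<bar> \<Longrightarrow> 2 * \<bar>u\<bar> powr p + 1 \<le> \<epsilon> * cosh u"
proof -
  have "((\<lambda>u::real. (2 * u powr p + 1) / exp u) \<longlongrightarrow> 0) at_top" by real_asymp
  then have "eventually (\<lambda>u::real. (2 * u powr p + 1) / exp u < \<epsilon> / 2) at_top"
    using assms by (intro order_tendstoD) auto
  then obtain N where N: "\<And>u. N \<le> u \<Longrightarrow> (2 * u powr p + 1) / exp u < \<epsilon> / 2"
    by (auto simp: eventually_at_top_linorder)
  obtain K0 :: nat where K0: "N \<le> real K0" using real_arch_simple by blast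
  show thesis
  proof
    show "1 \<le> Suc K0" by simp
    fix u :: real assume u: "real (Suc K0) \<le> \<bar>u\<bar>"
    then have "(2 * \<bar>u\<bar> powr p + 1) / exp \<bar>u\<bar> < \<epsilon> / 2" using K0 by (intro N) auto
    then have "2 * \<bar>u\<bar> powr p + 1 < \<epsilon> * (exp \<bar>u\<bar> / 2)" by (simp add: field_simps)
    also have "\<dots> \<le> \<epsilon> * cosh \<bar>u\<bar>" using assms
      by (intro mult_left_mono) (auto simp: cosh_field_def)
    finally show "2 * \<bar>u\<bar> powr p + 1 \<le> \<epsilon> * cosh u" by (simp add: cosh_real_abs)
  qed
qed

lemma integrable_abs_powr_std_normal:
  assumes "0 < p"
  shows "integrable std_normal_distribution (\<lambda>u. \<bar>u\<bar> powr p)"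
proof -
  interpret prob_space std_normal_distribution by (rule prob_space_std_normal)
  obtain K :: nat where K: "1 \<le> K" "\<And>u. real K \<le> \<bar>u\<bar> \<Longrightarrow> 2 * \<bar>u\<bar> powr p + 1 \<le> 1 * cosh u"
    by (rule cosh_dominates_powr[of 1 p]) auto
  have cosh: "integrable std_normal_distribution cosh"
    using has_bochner_integral_cosh_std_normal[of 1] by (simp add: has_bochner_integral_iff)
  show ?thesis
  proof (rule Bochner_Integration.integrable_bound)
    show "integrable std_normal_distribution (\<lambda>u. real K powr p + cosh u)"
      using cosh by simp
    have "\<bar>u\<bar> powr p \<le> real K powr p + cosh u" for u
    proof (cases "\<bar>u\<bar> \<le> real K")
      case True
      then have "\<bar>u\<bar> powr p \<le> real K powr p" using assms by (intro powr_mono2) auto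
      then show ?thesis using cosh_real_pos[of u] by linarith
    next
      case False
      then have "2 * \<bar>u\<bar> powr p + 1 \<le> cosh u" using K(2)[of u] by simp
      then show ?thesis using powr_ge_zero[of "\<bar>u\<bar>" p] powr_ge_zero[of "real K" p] by linarith
    qed
    then show "AE u in std_normal_distribution. norm (\<bar>u\<bar> powr p) \<le> norm (real K powr p + cosh u)"
      by (intro AE_I2) (auto intro: order_trans[OF _ abs_ge_self])
  qed simp
qed

text \<open>On \<open>[-K, K]\<close> the function is a continuous function of \<open>cos (pi / K * u)\<close>, hence uniformly close to a
  polynomial in it by Weierstrass. Outside, that polynomial stays bounded by \<open>K powr p + 1\<close> by periodicity,
  and for \<open>K\<close> large the whole error is absorbed by \<open>cosh\<close>.\<close>

lemma abs_powr_trig_approx: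
  assumes p: "0 < p" and \<epsilon>: "0 < \<epsilon>"
  obtains K :: nat and a :: "nat \<Rightarrow> real" and m where "1 \<le> K"
    "\<And>u. \<bar>\<bar>u\<bar> powr p - (\<Sum>i\<le>m. a i * cos (pi / real K * u) ^ i)\<bar> \<le> \<epsilon> * (1 + cosh u)"
proof -
  obtain K :: nat where K: "1 \<le> K" "\<And>u. real K \<le> \<bar>u\<bar> \<Longrightarrow> 2 * \<bar>u\<bar> powr p + 1 \<le> \<epsilon> * cosh u"
    using cosh_dominates_powr[OF \<epsilon>] by blast
  define g where "g = (\<lambda>v. (real K / pi * arccos v) powr p)"
  have "continuous_on {-1..1} g" unfolding g_def
    by (intro continuous_on_powr' continuous_intros continuous_on_arccos') (use p K in \<open>auto simp: arccos_lbound\<close>)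
  then obtain q where q: "real_polynomial_function q" "\<And>v. v \<in> {-1..1} \<Longrightarrow> \<bar>g v - q v\<bar> < min \<epsilon> 1"
    using Stone_Weierstrass_real_polynomial_function[of "{-1..1}" g "min \<epsilon> 1"] \<epsilon> by auto
  obtain a m where am: "q = (\<lambda>v. \<Sum>i\<le>m. a i * v ^ i)"
    using q(1) unfolding real_polynomial_function_iff_sum by blast
  have "\<bar>\<bar>u\<bar> powr p - q (cos (pi / real K * u))\<bar> \<le> \<epsilon> * (1 + cosh u)" for u
  proof -
    let ?v = "cos (pi / real K * u)"
    have v: "?v \<in> {-1..1}" by simp
    have cosh: "0 < cosh u" by (rule cosh_real_pos)
    show ?thesis
    proof (cases "\<bar>u\<bar> \<le> real K")
      case True
      have "\<bar>pi / real K * u\<bar> \<le> pi" using True K(1) by (simp add: abs_mult field_simps)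
      then have "arccos ?v = pi / real K * \<bar>u\<bar>" by (simp add: arccos_cos_eq_abs abs_mult)
      then have "g ?v = \<bar>u\<bar> powr p" using K(1) by (simp add: g_def)
      then have "\<bar>\<bar>u\<bar> powr p - q ?v\<bar> \<le> \<epsilon>" using q(2)[OF v] by simp
      also have "\<epsilon> \<le> \<epsilon> * (1 + cosh u)" using \<epsilon> cosh by simp
      finally show ?thesis .
    next
      case False
      have "0 \<le> arccos ?v" "arccos ?v \<le> pi" using v by (auto simp: arccos_lbound arccos_ubound)
      then have "0 \<le> real K / pi * arccos ?v" "real K / pi * arccos ?v \<le> real K"
        using mult_left_mono[of "arccos ?v" pi "real K"] by (simp_all add: field_simps)
      then have "g ?v \<le> \<bar>u\<bar> powr p" unfolding g_def using False p by (intro powr_mono2) auto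
      moreover have "0 \<le> g ?v" by (simp add: g_def)
      moreover have "\<bar>g ?v - q ?v\<bar> < 1" using q(2)[OF v] by simp
      ultimately have "\<bar>\<bar>u\<bar> powr p - q ?v\<bar> \<le> 2 * \<bar>u\<bar> powr p + 1" by linarith
      also have "\<dots> \<le> \<epsilon> * cosh u" using False by (intro K(2)) auto
      also have "\<dots> \<le> \<epsilon> * (1 + cosh u)" using \<epsilon> by simp
      finally show ?thesis .
    qed
  qed
  then show thesis using that[OF K(1)] unfolding am by blast
qed

lemma averages_bound:
  assumes f0: "\<And>u. 0 \<le> f u" and ave: "averages_out y (\<lambda>_. 1) f"
  shows "eventually (\<lambda>n. 1 / real n * (\<Sum>k<n. f (y n k)) \<le> gauss_mean f + 1) sequentially"
proof -
  have "eventually (\<lambda>n. 1 / real n * (\<Sum>k<n. 1 * (f (y n k) - gauss_mean f)) < 1) sequentially"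
    using ave by (intro order_tendstoD(2)[where y = 0]) (simp_all add: averages_out_def)
  with eventually_gt_at_top[of 0] show ?thesis
  proof eventually_elim
    case (elim n)
    then show ?case by (simp add: sum_subtractf field_simps)
  qed
qed

text \<open>Approximation in the norm weighted by \<open>w\<close> is enough, because the averages of \<open>w\<close> over the rows
  converge and therefore stay bounded.\<close>

lemma averages_out_approx:
  assumes h: "\<And>t. t \<in> {0..1} \<Longrightarrow> \<bar>h t\<bar> \<le> 1"
    and w: "\<And>u. 0 \<le> w u" "integrable std_normal_distribution w" "averages_out y (\<lambda>_. 1) w"
    and f: "integrable std_normal_distribution f"
    and approx: "\<And>\<epsilon>. 0 < \<epsilon> \<Longrightarrow> \<exists>g. integrable std_normal_distribution g \<and> averages_out y h g \<and>
      (\<forall>u. \<bar>f u - g u\<bar> \<le> \<epsilon> * w u)"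
  shows "averages_out y h f"
  unfolding averages_out_def
proof (rule tendstoI)
  fix e :: real assume e: "0 < e"
  \<comment> \<open>Bounds the mean of \<open>w\<close> plus its averages over all late rows.\<close>
  define B where "B = 2 * gauss_mean w + 1"
  have B: "0 < B" using w(1) by (simp add: B_def add_nonneg_pos integral_nonneg_AE)
  define \<epsilon> where "\<epsilon> = e / (2 * B)"
  have \<epsilon>: "0 < \<epsilon>" using e B by (simp add: \<epsilon>_def)
  obtain g where g: "integrable std_normal_distribution g" "averages_out y h g"
      "\<And>u. \<bar>f u - g u\<bar> \<le> \<epsilon> * w u"
    using approx[OF \<epsilon>] by blast
  have mean: "\<bar>gauss_mean f - gauss_mean g\<bar> \<le> \<epsilon> * gauss_mean w"
  proof -
    have "\<bar>gauss_mean f - gauss_mean g\<bar> = \<bar>gauss_mean (\<lambda>u. f u - g u)\<bar>" using f g by simp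
    also have "\<dots> \<le> gauss_mean (\<lambda>u. \<bar>f u - g u\<bar>)" by (rule integral_abs_bound)
    also have "\<dots> \<le> gauss_mean (\<lambda>u. \<epsilon> * w u)" using f g w by (intro integral_mono) auto
    finally show ?thesis by simp
  qed
  have "eventually (\<lambda>n. \<bar>1 / real n * (\<Sum>k<n. h (real k / real n) * (g (y n k) - gauss_mean g))\<bar> < e / 2) sequentially"
    using tendstoD[OF g(2)[unfolded averages_out_def], of "e / 2"] e by (simp add: dist_real_def)
  with averages_bound[OF w(1) w(3)] eventually_gt_at_top[of 0]
  show "eventually (\<lambda>n. dist (1 / real n * (\<Sum>k<n. h (real k / real n) * (f (y n k) - gauss_mean f))) 0 < e) sequentially"
  proof eventually_elim
    case (elim n)
    have "\<bar>1 / real n * (\<Sum>k<n. h (real k / real n) * (f (y n k) - gauss_mean f))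
        - 1 / real n * (\<Sum>k<n. h (real k / real n) * (g (y n k) - gauss_mean g))\<bar>
      = 1 / real n * \<bar>\<Sum>k<n. h (real k / real n) * ((f (y n k) - g (y n k)) - (gauss_mean f - gauss_mean g))\<bar>"
      unfolding right_diff_distrib[symmetric] sum_subtractf[symmetric] abs_mult
      by (simp add: algebra_simps)
    also have "\<dots> \<le> 1 / real n * (\<Sum>k<n. \<epsilon> * w (y n k) + \<epsilon> * gauss_mean w)"
    proof (intro mult_left_mono order_trans[OF sum_abs] sum_mono)
      fix k assume "k \<in> {..<n}"
      then have "\<bar>h (real k / real n)\<bar> \<le> 1" by (intro h) auto
      then have "\<bar>h (real k / real n) * ((f (y n k) - g (y n k)) - (gauss_mean f - gauss_mean g))\<bar>
          \<le> \<bar>(f (y n k) - g (y n k)) - (gauss_mean f - gauss_mean g)\<bar>"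
        unfolding abs_mult by (intro mult_left_le_one_le) auto
      also have "\<dots> \<le> \<epsilon> * w (y n k) + \<epsilon> * gauss_mean w"
        using g(3)[of "y n k"] mean by linarith
      finally show "\<bar>h (real k / real n) * ((f (y n k) - g (y n k)) - (gauss_mean f - gauss_mean g))\<bar>
        \<le> \<epsilon> * w (y n k) + \<epsilon> * gauss_mean w" .
    qed simp
    also have "\<dots> = \<epsilon> * (1 / real n * (\<Sum>k<n. w (y n k)) + gauss_mean w)"
      using elim by (simp add: sum.distrib sum_distrib_left[symmetric] field_simps)
    also have "\<dots> \<le> \<epsilon> * B" using elim \<epsilon> by (intro mult_left_mono) (auto simp: B_def)
    also have "\<dots> = e / 2" using B by (simp add: \<epsilon>_def)
    finally show ?case using elim(3) unfolding dist_real_def diff_0_right by linarith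
  qed
qed

lemma averages_out_abs_powr:
  assumes p: "0 < p" and h: "\<And>t. t \<in> {0..1} \<Longrightarrow> \<bar>h t\<bar> \<le> 1"
    and cosh: "averages_out y (\<lambda>_. 1) cosh"
    and cos: "\<And>(K::nat) (l::int). averages_out y h (\<lambda>u. cos (of_int l * (pi / real K * u)))"
  shows "averages_out y h (\<lambda>u. \<bar>u\<bar> powr p)"
proof (rule averages_out_approx[where w = "\<lambda>u. 1 + cosh u"])
  interpret prob_space std_normal_distribution by (rule prob_space_std_normal)
  have ci: "integrable std_normal_distribution cosh"
    using has_bochner_integral_cosh_std_normal[of 1] by (simp add: has_bochner_integral_iff)
  then show "integrable std_normal_distribution (\<lambda>u. 1 + cosh u)" by simp
  show "0 \<le> 1 + cosh u" for u :: real using cosh_real_pos[of u] by linarith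
  show "averages_out y (\<lambda>_. 1) (\<lambda>u. 1 + cosh u)"
    using cosh ci prob_space by (simp add: averages_out_def)
  show "integrable std_normal_distribution (\<lambda>u. \<bar>u\<bar> powr p)"
    using p by (rule integrable_abs_powr_std_normal)
  fix \<epsilon> :: real assume "0 < \<epsilon>"
  then obtain K :: nat and a m where K: "1 \<le> K"
    "\<And>u. \<bar>\<bar>u\<bar> powr p - (\<Sum>i\<le>m. a i * cos (pi / real K * u) ^ i)\<bar> \<le> \<epsilon> * (1 + cosh u)"
    using abs_powr_trig_approx[OF p] by metis
  have i: "integrable std_normal_distribution (\<lambda>u. cos (pi / real K * u) ^ i)" for i
  proof (rule integrable_bounded_std_normal[where B = 1])
    show "\<bar>cos (pi / real K * u) ^ i\<bar> \<le> 1" for u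
      unfolding power_abs by (intro power_le_one) auto
  qed measurable
  have "averages_out y h (\<lambda>u. cos (pi / real K * u) ^ i)" for i
    using averages_out_cos_power[where l = 0, OF cos[of _ K]] by simp
  then have "averages_out y h (\<lambda>u. \<Sum>i\<le>m. a i * cos (pi / real K * u) ^ i)"
    using i by (intro averages_out_sum)
  with K(2) i show "\<exists>g. integrable std_normal_distribution g \<and> averages_out y h g \<and>
      (\<forall>u. \<bar>\<bar>u\<bar> powr p - g u\<bar> \<le> \<epsilon> * (1 + cosh u))"
    by (intro exI[of _ "\<lambda>u. \<Sum>i\<le>m. a i * cos (pi / real K * u) ^ i"]) auto
qed (use h in auto)

text \<open>Polynomials are uniformly dense in the continuous weights, and replacing the weight costs at most
  its uniform error times the averages of \<open>f\<close>, which are bounded.\<close>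

lemma averages_out_continuous_weight:
  assumes h: "continuous_on {0..1} h" and f0: "\<And>u. 0 \<le> f u"
    and pow: "\<And>j::nat. averages_out y (\<lambda>t. t ^ j) f"
  shows "averages_out y h f"
  unfolding averages_out_def
proof (rule tendstoI)
  fix e :: real assume e: "0 < e"
  define A where "A = (\<lambda>h n. 1 / real n * (\<Sum>k<n. h (real k / real n) * (f (y n k) - gauss_mean f)))"
  define B where "B = 2 * gauss_mean f + 1"
  have g0: "0 \<le> gauss_mean f" using f0 by (simp add: integral_nonneg_AE)
  then have B: "0 < B" by (simp add: B_def)
  define \<epsilon> where "\<epsilon> = e / (2 * B)"
  have \<epsilon>: "0 < \<epsilon>" using e B by (simp add: \<epsilon>_def)
  obtain q where q: "real_polynomial_function q" "\<And>t. t \<in> {0..1} \<Longrightarrow> \<bar>h t - q t\<bar> < \<epsilon>"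
    using Stone_Weierstrass_real_polynomial_function[OF compact_Icc h \<epsilon>] by auto
  obtain a m where am: "q = (\<lambda>t. \<Sum>i\<le>m. a i * t ^ i)"
    using q(1) unfolding real_polynomial_function_iff_sum by blast
  have "A q = (\<lambda>n. \<Sum>i\<le>m. a i * A (\<lambda>t. t ^ i) n)"
    unfolding A_def am
    by (rule ext) (simp add: sum_distrib_left sum_distrib_right sum.swap[of _ "{..m}"] mult_ac)
  moreover have "(\<lambda>n. \<Sum>i\<le>m. a i * A (\<lambda>t. t ^ i) n) \<longlonglongrightarrow> (\<Sum>i\<le>m. a i * 0)"
    using pow by (intro tendsto_sum tendsto_mult tendsto_const) (simp add: averages_out_def A_def)
  ultimately have "A q \<longlonglongrightarrow> 0" by simp
  then have "eventually (\<lambda>n. \<bar>A q n\<bar> < e / 2) sequentially"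
    using tendstoD[of "A q" 0 sequentially "e / 2"] e by (simp add: dist_real_def)
  moreover have "averages_out y (\<lambda>_. 1) f" using pow[of 0] by simp
  then have "eventually (\<lambda>n. 1 / real n * (\<Sum>k<n. f (y n k)) \<le> gauss_mean f + 1) sequentially"
    by (rule averages_bound[OF f0])
  ultimately have "eventually (\<lambda>n. \<bar>A h n\<bar> < e) sequentially"
    using eventually_gt_at_top[of 0]
  proof eventually_elim
    case (elim n)
    have "\<bar>A h n - A q n\<bar> = 1 / real n * \<bar>\<Sum>k<n. (h (real k / real n) - q (real k / real n)) * (f (y n k) - gauss_mean f)\<bar>"
      unfolding A_def right_diff_distrib[symmetric] sum_subtractf[symmetric] abs_mult left_diff_distrib
      by simp
    also have "\<dots> \<le> 1 / real n * (\<Sum>k<n. \<epsilon> * (f (y n k) + gauss_mean f))"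
    proof (intro mult_left_mono order_trans[OF sum_abs] sum_mono)
      fix k assume "k \<in> {..<n}"
      then have "\<bar>h (real k / real n) - q (real k / real n)\<bar> \<le> \<epsilon>" by (intro less_imp_le q(2)) auto
      moreover have "\<bar>f (y n k) - gauss_mean f\<bar> \<le> f (y n k) + gauss_mean f"
        using f0[of "y n k"] g0 by linarith
      ultimately show "\<bar>(h (real k / real n) - q (real k / real n)) * (f (y n k) - gauss_mean f)\<bar>
          \<le> \<epsilon> * (f (y n k) + gauss_mean f)"
        unfolding abs_mult using \<epsilon> by (intro mult_mono) auto
    qed simp
    also have "\<dots> = \<epsilon> * (1 / real n * (\<Sum>k<n. f (y n k)) + gauss_mean f)"
      using elim by (simp add: sum.distrib sum_distrib_left[symmetric] field_simps)
    also have "\<dots> \<le> \<epsilon> * B" using elim \<epsilon> by (intro mult_left_mono) (auto simp: B_def)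
    also have "\<dots> = e / 2" using B by (simp add: \<epsilon>_def)
    finally show ?case using elim by linarith
  qed
  then show "eventually (\<lambda>n. dist (1 / real n * (\<Sum>k<n. h (real k / real n) * (f (y n k) - gauss_mean f))) 0 < e) sequentially"
    by (simp add: A_def dist_real_def)
qed

section \<open>Riemann sums and perturbations of power means\<close>

lemma riemann_sum_tendsto:
  fixes h :: "real \<Rightarrow> real"
  assumes h: "continuous_on {0..1} h"
  shows "(\<lambda>n. 1 / real n * (\<Sum>k<n. h (real k / real n))) \<longlonglongrightarrow> (LINT t:{0..1}|lborel. h t)"
proof (rule tendstoI)
  fix e :: real assume e: "0 < e"
  have "set_integrable lborel {0..1} h" 
    unfolding set_integrable_def using h by (intro borel_integrable_compact) auto
  then have I: "(LINT t:{0..1}|lborel. h t) = integral {0..1} h"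
    by (rule set_borel_integral_eq_integral)
  have "uniformly_continuous_on {0..1} h" using h by (intro compact_uniformly_continuous) auto
  then obtain d where d: "0 < d" "\<And>s t. s \<in> {0..1} \<Longrightarrow> t \<in> {0..1} \<Longrightarrow> \<bar>t - s\<bar> < d \<Longrightarrow> \<bar>h t - h s\<bar> < e / 2"
    unfolding uniformly_continuous_on_def dist_real_def using e by (meson half_gt_zero)
  obtain N :: nat where N: "0 < N" "1 / real N < d"
    using real_arch_inverse[of d] d(1) by (auto simp: inverse_eq_divide)
  show "eventually (\<lambda>n. dist (1 / real n * (\<Sum>k<n. h (real k / real n))) (LINT t:{0..1}|lborel. h t) < e) sequentially"
    using eventually_ge_at_top[of N]
  proof eventually_elim
    case (elim n)
    then have n: "0 < n" "1 / real n < d"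
      using N by (auto intro: le_less_trans[OF _ N(2)] simp: frac_le)
    have int: "h integrable_on {a..b}" if "0 \<le> a" "b \<le> 1" for a b
      using h that by (intro integrable_continuous_interval continuous_on_subset[OF h]) auto
    have "integral {0..real m / real n} h = (\<Sum>k<m. integral {real k / real n..real (Suc k) / real n} h)"
      if "m \<le> n" for m using that
    proof (induction m)
      case (Suc m)
      have "integral {0..real m / real n} h + integral {real m / real n..real (Suc m) / real n} h
          = integral {0..real (Suc m) / real n} h"
        using Suc.prems n by (intro Henstock_Kurzweil_Integration.integral_combine int) (auto simp: field_simps)
      with Suc show ?case by simp
    qed simp
    from this[of n] have split: "integral {0..1} h = (\<Sum>k<n. integral {real k / real n..real (Suc k) / real n} h)"
      using n by simp
    have loc: "\<bar>1 / real n * h (real k / real n) - integral {real k / real n..real (Suc k) / real n} h\<bar>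
        \<le> e / 2 * (1 / real n)" if "k < n" for k
    proof -
      let ?a = "real k / real n" and ?b = "real (Suc k) / real n"
      have ab: "?a \<le> ?b" "0 \<le> ?a" "?b \<le> 1" "?b - ?a = 1 / real n"
        using that n by (auto simp: field_simps)
      have "((\<lambda>t. h ?a - h t) has_integral (1 / real n * h ?a - integral {?a..?b} h)) {?a..?b}"
        using has_integral_diff[OF has_integral_const_real[of "h ?a" ?a ?b] integrable_integral[OF int[OF ab(2,3)]]]
          ab by simp
      moreover have "norm (h ?a - h t) \<le> e / 2" if t: "t \<in> {?a..?b} - {}" for t
      proof -
        have "\<bar>?a - t\<bar> < d" using t ab n(2) by auto
        moreover have "t \<in> {0..1}" "?a \<in> {0..1}"
          using t ab unfolding atLeastAtMost_iff Diff_empty by linarith+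
        ultimately show ?thesis using d(2)[of t ?a] by simp
      qed
      ultimately have "norm (1 / real n * h ?a - integral {?a..?b} h) \<le> e / 2 * measure lborel {?a..?b}"
        using e by (intro has_integral_bound_real[where S = "{}"]) auto
      then show ?thesis using ab by simp
    qed
    have "1 / real n * (\<Sum>k<n. h (real k / real n)) - integral {0..1} h
        = (\<Sum>k<n. 1 / real n * h (real k / real n) - integral {real k / real n..real (Suc k) / real n} h)"
      unfolding split sum_subtractf sum_distrib_left ..
    also have "\<bar>\<dots>\<bar> \<le> (\<Sum>k<n. e / 2 * (1 / real n))"
      by (intro order_trans[OF sum_abs] sum_mono loc) auto
    also have "\<dots> = e / 2" using n by simp
    finally show ?case using e unfolding I dist_real_def by linarith
  qed
qed

text \<open>The mean value theorem for \<open>t powr p\<close> between \<open>\<bar>a\<bar>\<close> and \<open>\<bar>a + b\<bar>\<close>.\<close>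

lemma abs_powr_add_diff_le:
  fixes a b p :: real
  assumes p: "1 \<le> p"
  shows "\<bar>\<bar>a + b\<bar> powr p - \<bar>a\<bar> powr p\<bar> \<le> p * \<bar>b\<bar> * (\<bar>a\<bar> + \<bar>b\<bar>) powr (p - 1)"
proof -
  have main: "v powr p - u powr p \<le> p * (v - u) * v powr (p - 1)" if "0 \<le> u" "u \<le> v" for u v :: real
  proof (cases "u = v")
    case False
    with that have uv: "u < v" by simp
    obtain z where z: "u < z" "z < v" "v powr p - u powr p = (v - u) * (p * z powr (p - 1))"
    proof -
      have "\<exists>z. u < z \<and> z < v \<and> v powr p - u powr p = (v - u) * (p * z powr (p - 1))"
      proof -
        have "continuous_on {u..v} (\<lambda>t. t powr p)"
          by (intro continuous_on_powr' continuous_intros) (use \<open>0 \<le> u\<close> p in auto)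
        moreover have "((\<lambda>t. t powr p) has_real_derivative p * t powr (p - 1)) (at t)" if "u < t" for t
          using that \<open>0 \<le> u\<close> by (auto intro!: derivative_eq_intros)
        ultimately obtain l z where "u < z" "z < v" "((\<lambda>t. t powr p) has_real_derivative l) (at z)"
            "v powr p - u powr p = (v - u) * l"
          using MVT[OF uv, of "\<lambda>t. t powr p"] by (metis real_differentiable_def)
        moreover have "((\<lambda>t. t powr p) has_real_derivative p * z powr (p - 1)) (at z)"
          using \<open>u < z\<close> \<open>0 \<le> u\<close> by (auto intro!: derivative_eq_intros)
        ultimately show ?thesis using DERIV_unique by blast
      qed
      with that show ?thesis by blast
    qed
    have "z powr (p - 1) \<le> v powr (p - 1)" using z that p by (intro powr_mono2) auto
    then have "(v - u) * (p * z powr (p - 1)) \<le> (v - u) * (p * v powr (p - 1))"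
      using uv p by (intro mult_left_mono) auto
    then show ?thesis unfolding z(3) by (simp add: mult_ac)
  qed simp
  let ?u = "min \<bar>a + b\<bar> \<bar>a\<bar>" and ?v = "max \<bar>a + b\<bar> \<bar>a\<bar>"
  have "\<bar>\<bar>a + b\<bar> powr p - \<bar>a\<bar> powr p\<bar> = ?v powr p - ?u powr p"
    using p powr_mono2[of p "\<bar>a + b\<bar>" "\<bar>a\<bar>"] powr_mono2[of p "\<bar>a\<bar>" "\<bar>a + b\<bar>"]
    by (simp add: max_def min_def)
  also have "\<dots> \<le> p * (?v - ?u) * ?v powr (p - 1)" by (intro main) auto
  also have "\<dots> \<le> p * \<bar>b\<bar> * (\<bar>a\<bar> + \<bar>b\<bar>) powr (p - 1)"
    by (intro mult_mono powr_mono2) (use p in auto)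
  finally show ?thesis .
qed

text \<open>A uniformly small perturbation changes the mean by at most a small multiple of the mean
  itself plus one, and the means converge.\<close>

lemma power_mean_perturbation:
  fixes a b :: "nat \<Rightarrow> nat \<Rightarrow> real"
  assumes p: "1 \<le> p"
    and lim: "(\<lambda>n. 1 / real n * (\<Sum>k<n. \<bar>a n k\<bar> powr p)) \<longlonglongrightarrow> l"
    and b: "\<And>n k. k < n \<Longrightarrow> \<bar>b n k\<bar> \<le> \<beta> n" and \<beta>: "\<beta> \<longlonglongrightarrow> 0"
  shows "(\<lambda>n. 1 / real n * (\<Sum>k<n. \<bar>a n k + b n k\<bar> powr p)) \<longlonglongrightarrow> l"
proof -
  define m where "m = (\<lambda>n. 1 / real n * (\<Sum>k<n. \<bar>a n k\<bar> powr p))"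
  have pointwise: "\<bar>\<bar>x + y\<bar> powr p - \<bar>x\<bar> powr p\<bar> \<le> p * \<delta> * (2 powr p * (\<bar>x\<bar> powr p + 1))"
    if "\<bar>y\<bar> \<le> \<delta>" "\<delta> \<le> 1" for x y \<delta> :: real
  proof -
    have d0: "0 \<le> \<delta>" using that(1) abs_ge_zero[of y] by linarith
    have "(\<bar>x\<bar> + \<bar>y\<bar>) powr (p - 1) \<le> (2 * max \<bar>x\<bar> 1) powr (p - 1)"
      using that p by (intro powr_mono2) auto
    also have "\<dots> \<le> (2 * max \<bar>x\<bar> 1) powr p" by (intro powr_mono) auto
    also have "\<dots> = 2 powr p * (max \<bar>x\<bar> 1) powr p" by (simp add: powr_mult)
    also have "\<dots> \<le> 2 powr p * (\<bar>x\<bar> powr p + 1)"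
      by (intro mult_left_mono) (auto simp: max_def)
    finally have "(\<bar>x\<bar> + \<bar>y\<bar>) powr (p - 1) \<le> 2 powr p * (\<bar>x\<bar> powr p + 1)" .
    then have "p * \<bar>y\<bar> * (\<bar>x\<bar> + \<bar>y\<bar>) powr (p - 1) \<le> p * \<delta> * (2 powr p * (\<bar>x\<bar> powr p + 1))"
      using that(1) p d0 by (intro mult_mono) auto
    with abs_powr_add_diff_le[OF p, of x y] show ?thesis by linarith
  qed
  have "(\<lambda>n. 1 / real n * (\<Sum>k<n. \<bar>a n k + b n k\<bar> powr p) - m n) \<longlonglongrightarrow> 0"
  proof (rule Lim_null_comparison)
    have "eventually (\<lambda>n. \<beta> n < 1) sequentially" using \<beta> by (intro order_tendstoD) auto
    with eventually_gt_at_top[of 0]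
    show "eventually (\<lambda>n. norm (1 / real n * (\<Sum>k<n. \<bar>a n k + b n k\<bar> powr p) - m n)
        \<le> p * \<beta> n * (2 powr p * (m n + 1))) sequentially"
    proof eventually_elim
      case (elim n)
      have "norm (1 / real n * (\<Sum>k<n. \<bar>a n k + b n k\<bar> powr p) - m n)
          = 1 / real n * \<bar>\<Sum>k<n. \<bar>a n k + b n k\<bar> powr p - \<bar>a n k\<bar> powr p\<bar>"
        unfolding m_def right_diff_distrib[symmetric] sum_subtractf real_norm_def abs_mult by simp
      also have "\<dots> \<le> 1 / real n * (\<Sum>k<n. p * \<beta> n * (2 powr p * (\<bar>a n k\<bar> powr p + 1)))"
        using elim by (intro mult_left_mono order_trans[OF sum_abs] sum_mono pointwise b) auto
      also have "\<dots> = p * \<beta> n * (2 powr p * (1 / real n * (\<Sum>k<n. \<bar>a n k\<bar> powr p + 1)))"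
        unfolding sum_distrib_left[symmetric] by simp
      also have "1 / real n * (\<Sum>k<n. \<bar>a n k\<bar> powr p + 1) = m n + 1"
        using elim by (simp add: m_def sum.distrib distrib_left)
      finally show ?case .
    qed
    have "(\<lambda>n. p * \<beta> n * (2 powr p * (m n + 1))) \<longlonglongrightarrow> p * 0 * (2 powr p * (l + 1))"
      using lim \<beta> by (intro tendsto_intros) (simp_all add: m_def)
    then show "(\<lambda>n. p * \<beta> n * (2 powr p * (m n + 1))) \<longlonglongrightarrow> 0" by simp
  qed
  from tendsto_add[OF this, of m l] lim show ?thesis by (simp add: m_def)
qed

section \<open>Power variation of controlled processes\<close>

lemma averages_out_imp_tendsto:
  assumes h: "continuous_on {0..1} h" and ave: "averages_out y h f"
  shows "(\<lambda>n. 1 / real n * (\<Sum>k<n. h (real k / real n) * f (y n k)))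
    \<longlonglongrightarrow> gauss_mean f * (LINT t:{0..1}|lborel. h t)"
proof -
  have "(\<lambda>n. 1 / real n * (\<Sum>k<n. h (real k / real n) * (f (y n k) - gauss_mean f))
      + gauss_mean f * (1 / real n * (\<Sum>k<n. h (real k / real n))))
    \<longlonglongrightarrow> 0 + gauss_mean f * (LINT t:{0..1}|lborel. h t)"
    using ave riemann_sum_tendsto[OF h] unfolding averages_out_def by (intro tendsto_intros)
  moreover have "1 / real n * (\<Sum>k<n. h (real k / real n) * (f (y n k) - gauss_mean f))
      + gauss_mean f * (1 / real n * (\<Sum>k<n. h (real k / real n)))
    = 1 / real n * (\<Sum>k<n. h (real k / real n) * f (y n k))" for n
    by (simp add: right_diff_distrib sum_subtractf sum_distrib_left sum_divide_distrib mult_ac)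
  ultimately show ?thesis by simp
qed

text \<open>The exceptional null set must not depend on \<open>h\<close>, since \<open>h\<close> will be a random path. It is the union of
  the null sets of the countably many pairs of a monomial weight and a cosine of frequency
  \<open>l * pi / K\<close>, and of the one for \<open>cosh\<close>.\<close>

lemma AE_averages_out_abs_powr:
  assumes P: "prob_space M" and \<nu>: "0 < \<nu>" "\<nu> \<le> 1 / 2"
    and fbm: "fractional_brownian_motion M \<nu> x" and p: "0 < p"
  shows "AE \<omega> in M. \<forall>h. continuous_on {0..1} h \<longrightarrow>
    averages_out (\<lambda>n k. normalized_increment x \<nu> n k \<omega>) h (\<lambda>u. \<bar>u\<bar> powr p)"
proof -
  have kernel: "AE \<omega> in M. averages_out (\<lambda>n k. normalized_increment x \<nu> n k \<omega>) (\<lambda>t. t ^ j) c"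
    if c: "gaussian_dalembert c s" for c s and j :: nat
  proof -
    have "gauss_mean c = exp (s / 2)"
      using gaussian_dalembert.std_normal[OF c, of 1] by (simp add: has_bochner_integral_iff)
    then show ?thesis
      using AE_dalembert_averages[OF P \<nu> fbm c, of j] by (simp add: averages_out_def)
  qed
  have "AE \<omega> in M. \<forall>j K (l::int). averages_out (\<lambda>n k. normalized_increment x \<nu> n k \<omega>) (\<lambda>t. t ^ j)
      (\<lambda>u. cos (of_int l * (pi / real K * u)))"
    using kernel[OF gaussian_dalembert_cos] unfolding AE_all_countable mult.assoc[symmetric] by blast
  moreover have "AE \<omega> in M. averages_out (\<lambda>n k. normalized_increment x \<nu> n k \<omega>) (\<lambda>_. 1) cosh"
    using kernel[OF gaussian_dalembert_cosh[of 1], of 0] by simp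
  ultimately show ?thesis
  proof eventually_elim
    case (elim \<omega>)
    show ?case
    proof (intro allI impI, rule averages_out_continuous_weight)
      show "averages_out (\<lambda>n k. normalized_increment x \<nu> n k \<omega>) (\<lambda>t. t ^ j) (\<lambda>u. \<bar>u\<bar> powr p)" for j :: nat
        using elim p by (intro averages_out_abs_powr) (auto simp: power_abs intro: power_le_one)
    qed auto
  qed
qed

theorem corollary4p16:
  fixes M :: "'a measure" and x z z' :: "real \<Rightarrow> 'a \<Rightarrow> real"
    and G :: "'a \<Rightarrow> ereal" and \<nu> p :: real
  assumes "prob_space M"
    and "0 < \<nu>" and "\<nu> \<le> 1 / 2"
    and "fractional_brownian_motion M \<nu> x"
    and "controlled_process M \<nu> x z z'"
    and "as_finite_rv M G"
    and "AE \<omega> in M. \<forall>s t. 0 \<le> s \<and> s \<le> t \<and> t \<le> 1 \<longrightarrow>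
           ereal \<bar>remainder x z z' s t \<omega>\<bar> \<le> G \<omega> * ereal ((t - s) powr (2 * \<nu>))"
    and "1 / (2 * \<nu>) < p"
  shows "AE \<omega> in M.
    (\<lambda>n::nat. 1 / real n * (\<Sum>k<n.
        \<bar>real n powr \<nu> * increment z (real k / real n) (real (Suc k) / real n) \<omega>\<bar> powr p))
    \<longlonglongrightarrow> abs_normal_moment p * (LINT t:{0..1}|lborel. \<bar>z' t \<omega>\<bar> powr p)"
proof -
  have "1 \<le> 1 / (2 * \<nu>)" using assms(2,3) by (simp add: field_simps)
  with assms(8) have p: "1 < p" by linarith
  have cont: "AE \<omega> in M. continuous_on {0..1} (\<lambda>t. z' t \<omega>)"
    using assms(5) by (simp add: controlled_process_def continuous_process_def)
  have fin: "AE \<omega> in M. \<bar>G \<omega>\<bar> \<noteq> \<infinity>" using assms(6) by (simp add: as_finite_rv_def)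
  have ave: "AE \<omega> in M. \<forall>h. continuous_on {0..1} h \<longrightarrow>
      averages_out (\<lambda>n k. normalized_increment x \<nu> n k \<omega>) h (\<lambda>u. \<bar>u\<bar> powr p)"
    using assms p by (intro AE_averages_out_abs_powr) auto
  from cont fin ave assms(7) show ?thesis
  proof eventually_elim
    case (elim \<omega>)
    define g where "g = real_of_ereal (G \<omega>)"
    have G: "G \<omega> = ereal g" using elim(2) by (simp add: g_def ereal_real)
    let ?h = "\<lambda>t. \<bar>z' t \<omega>\<bar> powr p"
    have h: "continuous_on {0..1} ?h"
      using elim(1) p by (intro continuous_on_powr' continuous_intros) auto
    \<comment> \<open>The increment of \<open>z\<close> is its first-order part plus a remainder that is smaller by a factor \<open>n powr (- \<nu>)\<close>.\<close>
    define a where "a = (\<lambda>n k. z' (real k / real n) \<omega> * normalized_increment x \<nu> n k \<omega>)"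
    define b where "b = (\<lambda>n k. real n powr \<nu> * remainder x z z' (real k / real n) (real (Suc k) / real n) \<omega>)"
    have "(\<lambda>n. 1 / real n * (\<Sum>k<n. \<bar>a n k\<bar> powr p))
        \<longlonglongrightarrow> abs_normal_moment p * (LINT t:{0..1}|lborel. ?h t)"
      using averages_out_imp_tendsto[OF h elim(3)[rule_format, OF h]]
      by (simp add: a_def abs_mult powr_mult abs_normal_moment_def)
    moreover have "\<bar>b n k\<bar> \<le> g * real n powr (- \<nu>)" if k: "k < n" for n k
    proof -
      have "0 \<le> real k / real n" "real k / real n \<le> real (Suc k) / real n" "real (Suc k) / real n \<le> 1"
        using k by (auto simp: divide_simps)
      moreover have "real (Suc k) / real n - real k / real n = 1 / real n"
        by (simp add: diff_divide_distrib[symmetric])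
      ultimately have "\<bar>remainder x z z' (real k / real n) (real (Suc k) / real n) \<omega>\<bar>
          \<le> g * (1 / real n) powr (2 * \<nu>)"
        using elim(4)[rule_format, of "real k / real n" "real (Suc k) / real n"] by (simp add: G)
      then have "\<bar>b n k\<bar> \<le> real n powr \<nu> * (g * (1 / real n) powr (2 * \<nu>))"
        unfolding b_def abs_mult by (intro mult_mono) auto
      also have "\<dots> = g * (real n powr \<nu> * real n powr (- (2 * \<nu>)))"
        using k by (simp add: powr_minus powr_divide field_simps)
      also have "real n powr \<nu> * real n powr (- (2 * \<nu>)) = real n powr (- \<nu>)"
        by (simp add: powr_add[symmetric])
      finally show ?thesis .
    qed
    moreover have "(\<lambda>n. g * real n powr (- \<nu>)) \<longlonglongrightarrow> 0"
    proof -
      have "(\<lambda>n. real n powr (- \<nu>)) \<longlonglongrightarrow> 0"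
        using assms(2) by (intro tendsto_neg_powr filterlim_real_sequentially) auto
      then show ?thesis by (rule tendsto_mult_right_zero)
    qed
    ultimately have "(\<lambda>n. 1 / real n * (\<Sum>k<n. \<bar>a n k + b n k\<bar> powr p))
        \<longlonglongrightarrow> abs_normal_moment p * (LINT t:{0..1}|lborel. ?h t)"
      using p by (intro power_mean_perturbation[where \<beta> = "\<lambda>n. g * real n powr (- \<nu>)"]) auto
    moreover have "a n k + b n k = real n powr \<nu> * increment z (real k / real n) (real (Suc k) / real n) \<omega>" for n k
      by (simp add: a_def b_def normalized_increment_def remainder_def algebra_simps)
    ultimately show ?case by simp
  qed
qed

end
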